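(* Let $p$ be a prime and let $G$ be a pro-$p$ group. The following are equivalent: (i) $G$ is either (isomorphic to) $\mathbb{Z}_p$ or has finite obliquity; (ii) there is a constant $k$ such that $\mathrm{ob}_G(n)\le kn$ for all $n$.
   Context: All subgroups are closed; $n$ ranges over positive integers. For a profinite group $G$ and a subgroup $H$, define $$\mathrm{Ob}_G(H)=H\cap\bigcap\{K\mid K \text{ open normal in } G,\ K\not\le H\}.$$ Let $I^\lhd_n(G)$ be the intersection of all open normal subgroups of $G$ of index at most $n$, and put $\mathrm{ob}_G(n)=|G:\mathrm{Ob}_G(I^\lhd_n(G))|\in\mathbb{N}\cup\{\infty\}$. Obliquity: let $G$ be a pro-$p$ group for which each lower central subgroup $\gamma_i(G)$ is an open subgroup. The $i$-th obliquity of $G$ is $o_i(G)=\log_p(|\gamma_{i+1}(G):\mathrm{Ob}_G(\gamma_{i+1}(G))|)$, with $\log_p(\infty)=\infty$, and the obliquity of $G$ is $o(G)=\sup_{i\in\mathbb{N}}o_i(G)$. "$G$ has finite obliquity" means that every lower central subgroup of $G$ is open and $o(G)<\infty$. *)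

theory Defs
  imports
    "HOL-Algebra.Elementary_Groups"
    "HOL-Algebra.Product_Groups"
    "HOL-Analysis.Analysis"
begin

locale topological_group = group G for G (structure) +
  fixes T :: "'a topology"
  assumes topspace_eq_carrier: "topspace T = carrier G"
    and continuous_mult: "continuous_map (prod_topology T T) T (\<lambda>(x, y). x \<otimes> y)"
    and continuous_inv: "continuous_map T T (\<lambda>x. inv x)"

(* Profinite and pro-p groups follow Dixon, du Sautoy, Mann and Segal,
   "Analytic pro-p groups", Definitions 1.1 and 1.10. *)

locale profinite_group = topological_group +
  assumes compact: "compact_space T"
    and Hausdorff: "Hausdorff_space T"
    and open_subgroup_base:
      "\<And>U. openin T U \<Longrightarrow> \<one> \<in> U \<Longrightarrow> \<exists>H. subgroup H G \<and> openin T H \<and> H \<subseteq> U"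

definition sub_index :: "('a, 'b) monoid_scheme \<Rightarrow> 'a set \<Rightarrow> 'a set \<Rightarrow> enat" where
  "sub_index G K H =
     (let C = rcosets\<^bsub>G\<lparr>carrier := K\<rparr>\<^esub> H in if finite C then enat (card C) else \<infinity>)"

definition group_index :: "('a, 'b) monoid_scheme \<Rightarrow> 'a set \<Rightarrow> enat" where
  "group_index G H = sub_index G (carrier G) H"

definition open_normal :: "('a, 'b) monoid_scheme \<Rightarrow> 'a topology \<Rightarrow> 'a set \<Rightarrow> bool" where
  "open_normal G T N \<longleftrightarrow> N \<lhd> G \<and> openin T N"

locale pro_p_group = profinite_group G T for p :: nat and G (structure) and T +
  assumes index_prime_power: "\<And>N. open_normal G T N \<Longrightarrow> \<exists>k. group_index G N = enat (p ^ k)"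

definition Ob :: "('a, 'b) monoid_scheme \<Rightarrow> 'a topology \<Rightarrow> 'a set \<Rightarrow> 'a set" where
  "Ob G T H = H \<inter> \<Inter>{K. open_normal G T K \<and> \<not> K \<subseteq> H}"

(* Meaningful for n > 0, when the family contains the whole group. *)
definition normal_core_upto :: "('a, 'b) monoid_scheme \<Rightarrow> 'a topology \<Rightarrow> nat \<Rightarrow> 'a set" where
  "normal_core_upto G T n = \<Inter>{N. open_normal G T N \<and> group_index G N \<le> enat n}"

definition ob :: "('a, 'b) monoid_scheme \<Rightarrow> 'a topology \<Rightarrow> nat \<Rightarrow> enat" where
  "ob G T n = group_index G (Ob G T (normal_core_upto G T n))"

definition commutator_subgroup ::
    "('a, 'b) monoid_scheme \<Rightarrow> 'a topology \<Rightarrow> 'a set \<Rightarrow> 'a set \<Rightarrow> 'a set" where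
  "commutator_subgroup G T H K =
     T closure_of
       generate G {h \<otimes>\<^bsub>G\<^esub> k \<otimes>\<^bsub>G\<^esub> inv\<^bsub>G\<^esub> h \<otimes>\<^bsub>G\<^esub> inv\<^bsub>G\<^esub> k | h k. h \<in> H \<and> k \<in> K}"

(* The series starts at index 1; the value at 0 is a dummy. *)
fun lower_central :: "('a, 'b) monoid_scheme \<Rightarrow> 'a topology \<Rightarrow> nat \<Rightarrow> 'a set" where
  "lower_central G T 0 = carrier G"
| "lower_central G T (Suc 0) = carrier G"
| "lower_central G T (Suc (Suc i)) =
     commutator_subgroup G T (lower_central G T (Suc i)) (carrier G)"

definition elog :: "nat \<Rightarrow> enat \<Rightarrow> ereal" where
  "elog p m = (case m of enat k \<Rightarrow> ereal (log (real p) (real k)) | \<infinity> \<Rightarrow> \<infinity>)"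

definition obliquity_at ::
    "nat \<Rightarrow> ('a, 'b) monoid_scheme \<Rightarrow> 'a topology \<Rightarrow> nat \<Rightarrow> ereal" where
  "obliquity_at p G T i =
     (let \<gamma> = lower_central G T (i + 1) in elog p (sub_index G \<gamma> (Ob G T \<gamma>)))"

definition obliquity :: "nat \<Rightarrow> ('a, 'b) monoid_scheme \<Rightarrow> 'a topology \<Rightarrow> ereal" where
  "obliquity p G T = (SUP i\<in>{1..}. obliquity_at p G T i)"

definition finite_obliquity :: "nat \<Rightarrow> ('a, 'b) monoid_scheme \<Rightarrow> 'a topology \<Rightarrow> bool" where
  "finite_obliquity p G T \<longleftrightarrow>
     (\<forall>i\<ge>1. openin T (lower_central G T i)) \<and> obliquity p G T < \<infinity>"

(* The p-adic integers as the inverse limit of the groups Z / p^n Z, with residues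
   represented in {0..<p^n}. *)
definition padic_int_group :: "nat \<Rightarrow> (nat \<Rightarrow> int) monoid" where
  "padic_int_group p =
     (product_group UNIV (\<lambda>n. integer_mod_group (p ^ n)))
       \<lparr>carrier := {x \<in> carrier (product_group UNIV (\<lambda>n. integer_mod_group (p ^ n))).
                     \<forall>n. x (Suc n) mod int (p ^ n) = x n}\<rparr>"

definition padic_int_topology :: "nat \<Rightarrow> (nat \<Rightarrow> int) topology" where
  "padic_int_topology p =
     subtopology
       (product_topology (\<lambda>n. discrete_topology (carrier (integer_mod_group (p ^ n)))) UNIV)
       (carrier (padic_int_group p))"

definition topological_group_iso ::
    "('a, 'b) monoid_scheme \<Rightarrow> 'a topology \<Rightarrow> ('c, 'd) monoid_scheme \<Rightarrow> 'c topology \<Rightarrow> bool" where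
  "topological_group_iso G T G' T' \<longleftrightarrow> (\<exists>f. f \<in> iso G G' \<and> homeomorphic_map T T' f)"

end

theory Submission
  imports Defs "HOL-Algebra.Group_Action" "HOL-Algebra.Multiplicative_Group"
begin

text \<open>
Write \<open>\<gamma>\<^sub>1 = G\<close>, \<open>\<gamma>\<^sub>2\<close>, \<dots> for the lower central series (\<open>\<gamma>\<^sub>i\<^sub>+\<^sub>1\<close> is \<open>lc i\<close> below) and \<open>I n\<close> for \<open>normal_core_upto G T n\<close>.
The argument rests on two remarks: \<open>Ob\<close> is monotone in the subgroup, and an open normal subgroup not contained
in \<open>H\<close> contains \<open>Ob H\<close>.

Let \<open>G\<close> have finite obliquity, with \<open>|\<gamma>\<^sub>i : Ob \<gamma>\<^sub>i| \<le> c\<close> for all \<open>i\<close>. Then the indices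
\<open>|\<gamma>\<^sub>i : \<gamma>\<^sub>i\<^sub>+\<^sub>1|\<close> are bounded (\<open>lc_factor_bounded\<close>): the normal subgroup generated by \<open>\<gamma>\<^sub>i\<^sub>+\<^sub>2\<close> and an
element of \<open>\<gamma>\<^sub>i\<close> outside \<open>\<gamma>\<^sub>i\<^sub>+\<^sub>1\<close> has bounded order modulo \<open>\<gamma>\<^sub>i\<^sub>+\<^sub>2\<close> and contains
\<open>Ob \<gamma>\<^sub>i\<^sub>+\<^sub>1\<close>. Moreover \<open>\<gamma>\<^sub>i\<^sub>+\<^sub>c \<le> Ob \<gamma>\<^sub>i\<close> (\<open>lc_subset_Ob\<close>), because the finite quotients of \<open>G\<close> are \<open>p\<close>-groups
and act nilpotently on their normal subgroups.
If \<open>|G : \<gamma>\<^sub>i| \<le> n < |G : \<gamma>\<^sub>i\<^sub>+\<^sub>1|\<close>, every open normal subgroup of index at most \<open>n\<close> contains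
\<open>Ob \<gamma>\<^sub>i\<^sub>+\<^sub>1\<close>, so \<open>I n\<close> contains \<open>\<gamma>\<^sub>j\<close> with \<open>j = i + 1 + c\<close>. Therefore \<open>Ob \<gamma>\<^sub>j \<le> Ob (I n)\<close>, and the index
of \<open>Ob \<gamma>\<^sub>j\<close> is at most a constant times \<open>n\<close> (\<open>ob_linear_of_bounded_obliquity\<close>).
In the \<open>p\<close>-adic integers the open subgroups form a chain, which gives \<open>Ob (I n) = I n\<close> and
\<open>ob n \<le> n\<close> (\<open>ob_le_of_linear\<close>).

Conversely, let \<open>ob n \<le> k n\<close> for all positive \<open>n\<close>. If \<open>H\<close> is open and normal of index \<open>n\<close>, then \<open>I n \<le> H\<close>, so
\<open>Ob (I n) \<le> Ob H\<close> and \<open>|H : Ob H| \<le> k\<close> (\<open>Ob_index_bounded_of_ob_linear\<close>). This bounds the obliquity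
provided that all \<open>\<gamma>\<^sub>i\<close> are open. It also shows that every nontrivial closed normal subgroup is open
(\<open>just_infinite_of_Ob\<close>). Suppose that some \<open>\<gamma>\<^sub>i\<close> is not open. The first such term is trivial, so
the one before it is central and open. It cannot be generated by commutators, since these would have finite order
and would generate finite normal subgroups; hence it is \<open>G\<close> itself and \<open>G\<close> is abelian
(\<open>just_infinite_lc_cases\<close>). An infinite abelian just infinite pro-\<open>p\<close> group is isomorphic to the \<open>p\<close>-adic integers
(\<open>abelian_just_infinite_iso_padic\<close>).
\<close>

section \<open>Commutators and finite \<open>p\<close>-groups\<close>

text \<open>Together with associativity and the inverse of a product, these rules let the simplifier decide
  identities that hold in all groups.\<close>
lemma (in group) inv_cancel_left [simp]:
  assumes "x \<in> carrier G" "y \<in> carrier G"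
  shows "inv x \<otimes> (x \<otimes> y) = y" "x \<otimes> (inv x \<otimes> y) = y"
  using assms by (simp_all flip: m_assoc)

text \<open>The commutator, in the convention used for \<open>commutator_subgroup\<close>.\<close>
abbreviation (in group) comm :: "'a \<Rightarrow> 'a \<Rightarrow> 'a" where
  "comm x g \<equiv> x \<otimes> g \<otimes> inv x \<otimes> inv g"

lemma (in group) comm_mult_right:
  assumes "x \<in> carrier G" "g \<in> carrier G" "h \<in> carrier G"
    and "\<And>y. y \<in> carrier G \<Longrightarrow> comm x h \<otimes> y = y \<otimes> comm x h"
  shows "comm x (g \<otimes> h) = comm x g \<otimes> comm x h"
proof -
  have "comm x (g \<otimes> h) = comm x g \<otimes> (g \<otimes> comm x h \<otimes> inv g)"
    using assms(1-3) by (simp add: m_assoc inv_mult_group)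
  also have "g \<otimes> comm x h \<otimes> inv g = comm x h"
    using assms(1-3) assms(4)[of g, symmetric] by (simp add: inv_solve_right')
  finally show ?thesis .
qed

lemma (in group) comm_mult_left:
  assumes "x \<in> carrier G" "y \<in> carrier G" "g \<in> carrier G"
    and "\<And>z. z \<in> carrier G \<Longrightarrow> comm y g \<otimes> z = z \<otimes> comm y g"
  shows "comm (x \<otimes> y) g = comm x g \<otimes> comm y g"
proof -
  have "comm (x \<otimes> y) g = x \<otimes> comm y g \<otimes> g \<otimes> inv x \<otimes> inv g"
    using assms(1-3) by (simp add: m_assoc inv_mult_group)
  also have "\<dots> = x \<otimes> g \<otimes> inv x \<otimes> inv g \<otimes> comm y g"
  proof -
    have "comm y g \<otimes> (g \<otimes> inv x \<otimes> inv g) = (g \<otimes> inv x \<otimes> inv g) \<otimes> comm y g"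
      using assms(1-3) by (intro assms(4)) simp
    then have "x \<otimes> (comm y g \<otimes> (g \<otimes> inv x \<otimes> inv g)) = x \<otimes> ((g \<otimes> inv x \<otimes> inv g) \<otimes> comm y g)"
      by simp
    then show ?thesis using assms(1-3) by (simp add: m_assoc)
  qed
  finally show ?thesis .
qed

lemma (in group) comm_pow_left:
  assumes "x \<in> carrier G" "g \<in> carrier G"
    and "\<And>z. z \<in> carrier G \<Longrightarrow> comm x g \<otimes> z = z \<otimes> comm x g"
  shows "comm (x [^] (n::nat)) g = comm x g [^] n"
proof (induction n)
  case 0 then show ?case using assms by (simp add: m_assoc)
next
  case (Suc n) 
  show ?case using comm_mult_left[of "x [^] n" x g] assms Suc by simp
qed

lemma prime_dvd_of_dvd_primepow:
  assumes "prime (p::nat)" "d dvd p ^ k" "d \<noteq> 1"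
  shows "p dvd d"
proof -
  obtain i where "d = p ^ i" using divides_primepow_nat assms(1,2) by blast
  then show ?thesis using assms(3) by (cases i) auto
qed

lemma (in group) orbit_conjugation:
  assumes "x \<in> carrier G"
  shows "orbit G (\<lambda>g. \<lambda>h\<in>carrier G. g \<otimes> h \<otimes> inv g) x = (\<lambda>g. g \<otimes> x \<otimes> inv g) ` carrier G"
  unfolding orbit_def restrict_apply'[OF assms] by blast

lemma (in group) card_conjugacy_class_dvd:
  assumes "x \<in> carrier G"
  shows "card ((\<lambda>g. g \<otimes> x \<otimes> inv g) ` carrier G) dvd Coset.order G"
  using group_action.orbit_stabilizer_theorem[OF action_by_conjugation assms]
  unfolding orbit_conjugation[OF assms] by (rule subst) (rule dvd_triv_left)

text \<open>A finite group of prime power order has a nontrivial central element in each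
  nontrivial normal subgroup: the conjugacy classes in the subgroup have prime power size.\<close>
lemma (in group) p_group_normal_meets_center:
  assumes p: "prime (p::nat)" and ord: "Coset.order G = p ^ k"
    and H: "H \<lhd> G" and ne: "H \<noteq> {\<one>}"
  shows "\<exists>z\<in>H. z \<noteq> \<one> \<and> (\<forall>g\<in>carrier G. g \<otimes> z = z \<otimes> g)"
proof (rule ccontr)
  assume no: "\<not> ?thesis"
  interpret H: normal H G by fact
  have fin: "finite (carrier G)"
    using ord p by (metis order_gt_0_iff_finite zero_less_power prime_gt_0_nat)
  define cl where "cl x = (\<lambda>g. g \<otimes> x \<otimes> inv g) ` carrier G" for x
  have clH: "cl x \<subseteq> H" if "x \<in> H" for x
    unfolding cl_def using H.inv_op_closed2[OF _ that] by blast
  have self: "x \<in> cl x" if "x \<in> carrier G" for x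
  proof -
    have "\<one> \<otimes> x \<otimes> inv \<one> \<in> cl x" unfolding cl_def by (rule imageI) simp
    then show ?thesis using that by simp
  qed
  have dvd: "card (cl x) dvd p ^ k" if "x \<in> carrier G" for x
    using card_conjugacy_class_dvd[OF that] ord unfolding cl_def by simp
  have p_dvd: "p dvd card (cl x)" if "x \<in> H" "x \<noteq> \<one>" for x
  proof -
    have x: "x \<in> carrier G" using that by simp
    have "card (cl x) \<noteq> 1"
    proof
      assume "card (cl x) = 1"
      then obtain w where "cl x = {w}" by (rule card_1_singletonE)
      then have *: "cl x = {x}" using self[OF x] by simp
      have "g \<otimes> x = x \<otimes> g" if "g \<in> carrier G" for g
      proof -
        have "g \<otimes> x \<otimes> inv g = x" using * that by (auto simp: cl_def)
        then show ?thesis using x that by (metis inv_solve_right m_closed)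
      qed
      with no that show False by auto
    qed
    then show ?thesis using prime_dvd_of_dvd_primepow[OF p dvd[OF x]] by blast
  qed
  have cl1: "cl \<one> = {\<one>}" by (auto simp: cl_def image_iff)
  have disj: "cl x \<inter> cl y = {}" if "x \<in> H" "y \<in> H" "cl x \<noteq> cl y" for x y
  proof (rule ccontr)
    assume "cl x \<inter> cl y \<noteq> {}"
    then obtain z where z: "z \<in> cl x" "z \<in> cl y" by blast
    have eq: "cl z = cl u" if u: "u \<in> carrier G" "z \<in> cl u" for u
    proof -
      obtain g where g: "g \<in> carrier G" "z = g \<otimes> u \<otimes> inv g" using u unfolding cl_def by blast
      show ?thesis
      proof (rule equalityI; rule subsetI)
        fix v assume "v \<in> cl z"
        then obtain h where h: "h \<in> carrier G" "v = h \<otimes> z \<otimes> inv h" unfolding cl_def by blast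
        then have "v = (h \<otimes> g) \<otimes> u \<otimes> inv (h \<otimes> g)"
          using g u(1) by (simp add: m_assoc inv_mult_group)
        then show "v \<in> cl u" unfolding cl_def by (rule image_eqI) (use g h in simp)
      next
        fix v assume "v \<in> cl u"
        then obtain h where h: "h \<in> carrier G" "v = h \<otimes> u \<otimes> inv h" unfolding cl_def by blast
        then have "v = (h \<otimes> inv g) \<otimes> z \<otimes> inv (h \<otimes> inv g)"
          using g u(1) by (simp add: m_assoc inv_mult_group)
        then show "v \<in> cl z" unfolding cl_def by (rule image_eqI) (use g h in simp)
      qed
    qed
    have "cl z = cl x" "cl z = cl y"
      using eq[OF H.mem_carrier[OF that(1)] z(1)] eq[OF H.mem_carrier[OF that(2)] z(2)] by blast+
    with that(3) show False by blast
  qed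
  have Un: "\<Union>(cl ` H) = H"
  proof (rule equalityI)
    show "\<Union>(cl ` H) \<subseteq> H" using clH by (rule UN_least)
    show "H \<subseteq> \<Union>(cl ` H)" using self[OF H.mem_carrier] by (intro subsetI UN_I)
  qed
  have finH: "finite H" using fin H.subset finite_subset by blast
  have "card (\<Union>(cl ` H)) = sum card (cl ` H)"
    by (rule card_Union_disjoint)
       (use disj finite_subset[OF clH finH] in \<open>auto simp: pairwise_def disjnt_def\<close>)
  also have "\<dots> = card {\<one>} + sum card (cl ` H - {{\<one>}})"
  proof (rule sum.remove)
    show "finite (cl ` H)" using finH by simp
    show "{\<one>} \<in> cl ` H" using cl1 H.one_closed by (metis imageI)
  qed
  finally have "card H = 1 + sum card (cl ` H - {{\<one>}})" using Un by simp
  moreover have "p dvd sum card (cl ` H - {{\<one>}})"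
  proof (rule dvd_sum)
    fix C assume "C \<in> cl ` H - {{\<one>}}"
    then obtain x where "x \<in> H" "C = cl x" "cl x \<noteq> {\<one>}" by blast
    then show "p dvd card C" using p_dvd[of x] cl1 by (cases "x = \<one>") simp_all
  qed
  moreover have "p dvd card H"
  proof -
    have "card H dvd p ^ k" using lagrange[OF H.subgroup_axioms] ord 
      by (metis dvd_triv_right)
    moreover have "card H \<noteq> 1"
    proof
      assume "card H = 1"
      then obtain w where "H = {w}" by (rule card_1_singletonE)
      then show False using ne H.one_closed by simp
    qed
    ultimately show ?thesis using prime_dvd_of_dvd_primepow[OF p] by blast
  qed
  ultimately have "p dvd 1"
    using dvd_add_left_iff[of p "sum card (cl ` H - {{\<one>}})" 1] by simp
  then show False using p by simp
qed

section \<open>Subgroup indices and quotients\<close>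

text \<open>If all commutators of \<open>x\<close> are central, then \<open>comm x\<close> is a homomorphism, and the normal closure
  of \<open>x\<close> consists of the products of a power of \<open>x\<close> and a commutator of \<open>x\<close>. The set \<open>R\<close>, which
  represents all values of \<open>comm x\<close>, serves to bound its order.\<close>
lemma (in group) cyclic_times_comm:
  fixes E :: nat
  assumes x: "x \<in> carrier G" and E: "E > 0" "x [^] E = \<one>"
    and central: "\<And>g z. \<lbrakk>g \<in> carrier G; z \<in> carrier G\<rbrakk> \<Longrightarrow> comm x g \<otimes> z = z \<otimes> comm x g"
    and R: "finite R" "R \<subseteq> carrier G" "\<And>g. g \<in> carrier G \<Longrightarrow> \<exists>r\<in>R. comm x g = comm x r"
  defines "K \<equiv> {x [^] (a::nat) \<otimes> comm x g | a g. g \<in> carrier G}"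
  shows "K \<lhd> G" "x \<in> K" "finite K" "card K \<le> E * card R"
proof -
  define c where "c g = comm x g" for g
  have c_carr: "c g \<in> carrier G" if "g \<in> carrier G" for g
    using that x by (simp add: c_def)
  have c_mult: "c (g \<otimes> h) = c g \<otimes> c h" if "g \<in> carrier G" "h \<in> carrier G" for g h
    unfolding c_def by (rule comm_mult_right[OF x that central[OF that(2)]])
  have c_central: "c g \<otimes> z = z \<otimes> c g" if "g \<in> carrier G" "z \<in> carrier G" for g z
    unfolding c_def by (rule central[OF that])
  have c_one: "c \<one> = \<one>" using x by (simp add: c_def)
  interpret c: group_hom G G c
    by unfold_locales (auto simp: hom_def c_carr c_mult)
  have K: "K = {x [^] a \<otimes> c g | (a::nat) g. g \<in> carrier G}" by (simp add: K_def c_def)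
  have KI: "x [^] (a::nat) \<otimes> c g \<in> K" if "g \<in> carrier G" for a g
    using that unfolding K by blast
  have KE: "\<exists>(a::nat) g. g \<in> carrier G \<and> y = x [^] a \<otimes> c g" if "y \<in> K" for y
    using that unfolding K by blast
  have prod: "(x [^] a \<otimes> c g) \<otimes> (x [^] b \<otimes> c h) = x [^] (a + b) \<otimes> c (g \<otimes> h)"
    if "g \<in> carrier G" "h \<in> carrier G" for a b :: nat and g h
  proof -
    have "(x [^] a \<otimes> c g) \<otimes> (x [^] b \<otimes> c h) = x [^] a \<otimes> (c g \<otimes> x [^] b) \<otimes> c h"
      using x that by (simp add: m_assoc c_carr)
    also have "\<dots> = x [^] a \<otimes> (x [^] b \<otimes> c g) \<otimes> c h"
      using c_central[OF that(1), of "x [^] b"] x by simp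
    finally show ?thesis using x that by (simp add: m_assoc c_carr c_mult flip: nat_pow_mult)
  qed
  have sub: "subgroup K G"
  proof (rule subgroupI)
    show "K \<subseteq> carrier G" using x c_carr unfolding K by blast
    show "K \<noteq> {}" using KI[OF one_closed] by blast
  next
    fix y assume "y \<in> K"
    then obtain a :: nat and g where g: "g \<in> carrier G" "y = x [^] a \<otimes> c g" using KE by blast
    let ?w = "x [^] ((E - 1) * a) \<otimes> c (inv g)"
    have "y \<otimes> ?w = x [^] (a + (E - 1) * a) \<otimes> c (g \<otimes> inv g)"
      unfolding g(2) by (rule prod) (simp_all add: g)
    also have "a + (E - 1) * a = E * a" using E by (cases E) auto
    also have "x [^] (E * a) = \<one>" using E x by (simp flip: nat_pow_pow)
    also have "c (g \<otimes> inv g) = \<one>" using g c_one by simp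
    finally have "y \<otimes> ?w = \<one>" by simp
    moreover have car: "y \<in> carrier G" "?w \<in> carrier G"
      unfolding g(2) by (intro m_closed nat_pow_closed c_carr inv_closed x g(1))+
    ultimately have "?w \<otimes> y = \<one>" by (rule inv_comm)
    then have "inv y = ?w" by (rule inv_equality[OF _ car])
    also have "?w \<in> K" by (rule KI[OF inv_closed[OF g(1)]])
    finally show "inv y \<in> K" .
  next
    fix y z assume "y \<in> K" "z \<in> K"
    then obtain a b :: nat and g h where "g \<in> carrier G" "y = x [^] a \<otimes> c g" 
      "h \<in> carrier G" "z = x [^] b \<otimes> c h" using KE by meson
    then show "y \<otimes> z \<in> K" using prod KI m_closed by metis
  qed
  show "K \<lhd> G"
  proof (rule normal_invI[OF sub])
    fix h y assume h: "h \<in> carrier G" and "y \<in> K"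
    then obtain a :: nat and g where g: "g \<in> carrier G" "y = x [^] a \<otimes> c g" using KE by blast
    have "comm (x [^] a) h = c h [^] a"
      using comm_pow_left[OF x h central[OF h]] unfolding c_def .
    also have "\<dots> = c (h [^] a)" using c.hom_nat_pow[OF h] by simp
    finally have "inv (comm (x [^] a) h) = c (inv (h [^] a))" using h by simp
    then have *: "h \<otimes> x [^] a \<otimes> inv h \<otimes> inv (x [^] a) = c (inv (h [^] a))"
      using h x by (simp add: inv_mult_group m_assoc)
    have "h \<otimes> y \<otimes> inv h = (h \<otimes> x [^] a) \<otimes> (c g \<otimes> inv h)"
      using g h x by (simp add: m_assoc c_carr)
    also have "c g \<otimes> inv h = inv h \<otimes> c g" by (rule c_central) (use g h in auto)
    also have "(h \<otimes> x [^] a) \<otimes> (inv h \<otimes> c g)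
        = (h \<otimes> x [^] a \<otimes> inv h \<otimes> inv (x [^] a)) \<otimes> (x [^] a \<otimes> c g)"
      using g h x by (simp add: m_assoc c_carr)
    also have "\<dots> = (x [^] (0::nat) \<otimes> c (inv (h [^] a))) \<otimes> (x [^] a \<otimes> c g)"
      unfolding * using h c_carr by simp
    also have "\<dots> = x [^] (0 + a) \<otimes> c (inv (h [^] a) \<otimes> g)"
      by (rule prod) (use g h in auto)
    also have "\<dots> \<in> K" by (rule KI) (use g h in auto)
    finally show "h \<otimes> y \<otimes> inv h \<in> K" .
  qed
  show "x \<in> K" using KI[OF one_closed, of 1] x c_one by simp
  define F where "F = (\<lambda>(a::nat, r). x [^] a \<otimes> c r)"
  have KF: "K \<subseteq> F ` ({..<E} \<times> R)"
  proof
    fix y assume "y \<in> K"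
    then obtain a :: nat and g where g: "g \<in> carrier G" "y = x [^] a \<otimes> c g" using KE by blast
    have "x [^] a = x [^] (E * (a div E) + a mod E)" by simp
    also have "\<dots> = x [^] (E * (a div E)) \<otimes> x [^] (a mod E)" using x by (simp only: nat_pow_mult)
    also have "x [^] (E * (a div E)) = \<one>" using E x by (simp flip: nat_pow_pow)
    finally have 1: "x [^] a = x [^] (a mod E)" using x by simp
    obtain r where r: "r \<in> R" "c g = c r" using R(3)[OF g(1)] unfolding c_def by blast
    then have "y = F (a mod E, r)" unfolding F_def g(2) 1 by simp
    moreover have "(a mod E, r) \<in> {..<E} \<times> R" using E r by simp
    ultimately show "y \<in> F ` ({..<E} \<times> R)" by (rule image_eqI)
  qed
  have fin: "finite ({..<E} \<times> R)" using R(1) by simp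
  show "finite K" by (rule finite_subset[OF KF finite_imageI[OF fin, of F]])
  have "card K \<le> card (F ` ({..<E} \<times> R))" by (rule card_mono[OF finite_imageI[OF fin, of F] KF])
  also have "\<dots> \<le> card ({..<E} \<times> R)" by (rule card_image_le[OF fin])
  finally show "card K \<le> E * card R" by (simp add: card_cartesian_product)
qed

lemma (in normal) group_hom_Mod: "group_hom G (G Mod H) (\<lambda>a. H #> a)"
  using r_coset_hom_Mod factorgroup_is_group is_group by (simp add: group_hom_def group_hom_axioms_def)

lemma (in normal) rcos_eq_self_iff: "a \<in> carrier G \<Longrightarrow> H #> a = H \<longleftrightarrow> a \<in> H"
  using coset_join1[OF _ _ subgroup_axioms] coset_join2[OF _ subgroup_axioms] by blast

lemma (in normal) pow_index_mem:
  assumes "finite (rcosets H)" "x \<in> carrier G"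
  shows "x [^] card (rcosets H) \<in> H"
proof -
  have "(H #> x) [^]\<^bsub>G Mod H\<^esub> Coset.order (G Mod H) = \<one>\<^bsub>G Mod H\<^esub>"
    by (rule group.pow_order_eq_1[OF factorgroup_is_group])
       (use assms in \<open>auto simp: carrier_FactGroup\<close>)
  then have "H #> (x [^] card (rcosets H)) = H"
    unfolding FactGroup_pow[OF assms(2)] by (simp add: Coset.order_def FactGroup_def)
  then show ?thesis using rcos_eq_self_iff assms(2) by simp
qed

lemma (in normal) normal_vimage_Mod:
  assumes K: "K \<lhd> G Mod H"
  shows "{g \<in> carrier G. H #> g \<in> K} \<lhd> G"
proof -
  interpret Q: group "G Mod H" by (rule factorgroup_is_group)
  note hom = group_hom_Mod
  have K': "subgroup K (G Mod H)" by (rule normal_imp_subgroup[OF K])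
  have Qc: "H #> g \<in> carrier (G Mod H)" if "g \<in> carrier G" for g
    using that by (auto simp: carrier_FactGroup)
  have mult: "H #> (a \<otimes> b) = (H #> a) \<otimes>\<^bsub>G Mod H\<^esub> (H #> b)" if "a \<in> carrier G" "b \<in> carrier G" for a b
    using group_hom.hom_mult[OF hom that] .
  have inv: "H #> inv a = inv\<^bsub>G Mod H\<^esub> (H #> a)" if "a \<in> carrier G" for a
    using group_hom.hom_inv[OF hom that] .
  have "subgroup {g \<in> carrier G. H #> g \<in> K} G"
  proof (rule subgroupI)
    have one: "\<one> \<in> H" "\<one> \<in> carrier G" using is_subgroup subgroup.one_closed subset by blast+
    then have "H #> \<one> = H" using rcos_eq_self_iff by blast
    moreover have "H \<in> K" using subgroup.one_closed[OF K'] by simp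
    ultimately have "\<one> \<in> {g \<in> carrier G. H #> g \<in> K}" using one(2) by simp
    then show "{g \<in> carrier G. H #> g \<in> K} \<noteq> {}" by (metis empty_iff)
  next
    fix a assume "a \<in> {g \<in> carrier G. H #> g \<in> K}"
    then show "inv a \<in> {g \<in> carrier G. H #> g \<in> K}"
      using inv[of a] subgroup.m_inv_closed[OF K', of "H #> a"] by auto
  next
    fix a b assume "a \<in> {g \<in> carrier G. H #> g \<in> K}" "b \<in> {g \<in> carrier G. H #> g \<in> K}"
    then show "a \<otimes> b \<in> {g \<in> carrier G. H #> g \<in> K}"
      using mult[of a b] subgroup.m_closed[OF K', of "H #> a" "H #> b"] by auto
  qed blast
  then show ?thesis
  proof (rule normal_invI)
    fix g a assume g: "g \<in> carrier G" and "a \<in> {g \<in> carrier G. H #> g \<in> K}"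
    then have a: "a \<in> carrier G" "H #> a \<in> K" by auto
    have "H #> (g \<otimes> a \<otimes> inv g) = (H #> g) \<otimes>\<^bsub>G Mod H\<^esub> (H #> a) \<otimes>\<^bsub>G Mod H\<^esub> inv\<^bsub>G Mod H\<^esub> (H #> g)"
      using mult[of "g \<otimes> a" "inv g"] mult[of g a] inv[of g] a g by simp
    also have "\<dots> \<in> K" by (rule normal.inv_op_closed2[OF K Qc[OF g] a(2)])
    finally show "g \<otimes> a \<otimes> inv g \<in> {g \<in> carrier G. H #> g \<in> K}" using g a by simp
  qed
qed

lemma (in group) normal_Inter:
  assumes "F \<noteq> {}" "\<And>N. N \<in> F \<Longrightarrow> N \<lhd> G"
  shows "\<Inter>F \<lhd> G"
proof (rule normal_invI)
  show "subgroup (\<Inter>F) G" using assms by (intro subgroups_Inter) (auto dest: normal_imp_subgroup)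
next
  fix x h assume "x \<in> carrier G" "h \<in> \<Inter>F"
  then show "x \<otimes> h \<otimes> inv x \<in> \<Inter>F" using normal.inv_op_closed2[OF assms(2)] by blast
qed

lemma (in group) carrier_normal: "carrier G \<lhd> G"
  by (rule normal_invI[OF subgroup_self]) simp

lemma sub_index_eq:
  "sub_index G K H =
    (if finite ((\<lambda>a. H #>\<^bsub>G\<^esub> a) ` K) then enat (card ((\<lambda>a. H #>\<^bsub>G\<^esub> a) ` K)) else \<infinity>)"
proof -
  have "rcosets\<^bsub>G\<lparr>carrier := K\<rparr>\<^esub> H = (\<lambda>a. H #>\<^bsub>G\<^esub> a) ` K"
    by (auto simp: RCOSETS_def)
  then show ?thesis by (simp add: sub_index_def Let_def)
qed

lemma sub_index_mono:
  assumes "A \<subseteq> B"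
  shows "sub_index G A C \<le> sub_index G B C"
proof (cases "finite ((\<lambda>a. C #>\<^bsub>G\<^esub> a) ` B)")
  case True
  then show ?thesis unfolding sub_index_eq
    using assms finite_subset[OF image_mono[OF assms]] card_mono[OF True image_mono[OF assms]] by simp
qed (simp add: sub_index_eq)

lemma (in group) rcos_eq_iff:
  assumes "subgroup H G" "a \<in> carrier G" "b \<in> carrier G"
  shows "H #> a = H #> b \<longleftrightarrow> a \<otimes> inv b \<in> H"
  using assms by (metis subgroup.rcos_module[OF _ is_group] rcos_self repr_independence)

lemma (in group) sub_index_mult:
  assumes A: "subgroup A G" and B: "subgroup B G" and C: "subgroup C G"
    and BA: "B \<subseteq> A" and CB: "C \<subseteq> B"
  shows "sub_index G A C = sub_index G A B * sub_index G B C"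
proof -
  let ?X = "(\<lambda>a. B #> a) ` A" and ?Y = "(\<lambda>a. C #> a) ` B" and ?Z = "(\<lambda>a. C #> a) ` A"
  have Ac: "a \<in> carrier G" if "a \<in> A" for a using that A by (rule_tac subgroup.mem_carrier)
  have Bc: "a \<in> carrier G" if "a \<in> B" for a using that B by (rule_tac subgroup.mem_carrier)
  have Cc: "C \<subseteq> carrier G" using C by (rule subgroup.subset)
  define r where "r X = (SOME a. a \<in> A \<and> B #> a = X)" for X
  have r: "r X \<in> A" "B #> r X = X" if "X \<in> ?X" for X
    using someI_ex[of "\<lambda>a. a \<in> A \<and> B #> a = X"] that unfolding r_def by blast+
  define F where "F = (\<lambda>(X, Y). Y #> r X)"
  have F: "F (X, C #> b) = C #> (b \<otimes> r X)" if "X \<in> ?X" "b \<in> B" for X b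
    unfolding F_def prod.case using coset_mult_assoc[OF Cc] Bc[OF that(2)] Ac[OF r(1)[OF that(1)]] .
  have "bij_betw F (?X \<times> ?Y) ?Z"
    unfolding bij_betw_def
  proof (intro conjI inj_onI equalityI subsetI)
    fix u v assume "u \<in> ?X \<times> ?Y" "v \<in> ?X \<times> ?Y" and eq: "F u = F v"
    then obtain X b X' b' where u: "u = (X, C #> b)" "X \<in> ?X" "b \<in> B" 
      and v: "v = (X', C #> b')" "X' \<in> ?X" "b' \<in> B" by blast
    have car: "b \<in> carrier G" "b' \<in> carrier G" "r X \<in> carrier G" "r X' \<in> carrier G"
      using u v r Ac Bc by auto
    have *: "(b \<otimes> r X) \<otimes> inv (b' \<otimes> r X') \<in> C"
      using eq car unfolding u(1) v(1) F[OF u(2,3)] F[OF v(2,3)] by (subst (asm) rcos_eq_iff[OF C]) auto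
    then have "inv b \<otimes> ((b \<otimes> r X) \<otimes> inv (b' \<otimes> r X')) \<otimes> b' \<in> B"
      using subsetD[OF CB *] u(3) v(3)
      by (rule_tac subgroup.m_closed[OF B] subgroup.m_inv_closed[OF B] | assumption)+
    moreover have "inv b \<otimes> ((b \<otimes> r X) \<otimes> inv (b' \<otimes> r X')) \<otimes> b' = r X \<otimes> inv (r X')"
      using car by (simp add: m_assoc inv_mult_group)
    ultimately have "B #> r X = B #> r X'" using car by (subst rcos_eq_iff[OF B]) auto
    then have X: "X = X'" using r u v by blast
    have "(b \<otimes> r X) \<otimes> inv (b' \<otimes> r X') = b \<otimes> inv b'"
      using car unfolding X by (simp add: m_assoc inv_mult_group)
    then have "C #> b = C #> b'" using * car by (subst rcos_eq_iff[OF C]) auto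
    then show "u = v" using u v X by blast
  next
    fix z assume "z \<in> F ` (?X \<times> ?Y)"
    then obtain X b where u: "z = F (X, C #> b)" "X \<in> ?X" "b \<in> B" by blast
    have "b \<otimes> r X \<in> A" using u r BA by (intro subgroup.m_closed[OF A]) auto
    then show "z \<in> ?Z" unfolding u(1) F[OF u(2,3)] by (rule imageI)
  next
    fix z assume "z \<in> ?Z"
    then obtain a where a: "a \<in> A" "z = C #> a" by blast
    have X: "B #> a \<in> ?X" using a by blast
    let ?b = "a \<otimes> inv (r (B #> a))"
    have car: "a \<in> carrier G" "r (B #> a) \<in> carrier G" using a r[OF X] Ac by auto
    have b: "?b \<in> B" using r(2)[OF X] car by (subst rcos_eq_iff[OF B, symmetric]) auto
    have "F (B #> a, C #> ?b) = C #> a" unfolding F[OF X b] using car by (simp add: m_assoc)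
    then show "z \<in> F ` (?X \<times> ?Y)" using X b a by (intro image_eqI[of _ _ "(B #> a, C #> ?b)"]) auto
  qed
  then have fin: "finite ?Z \<longleftrightarrow> finite (?X \<times> ?Y)" and card: "card ?Z = card (?X \<times> ?Y)"
    using bij_betw_finite bij_betw_same_card by metis+
  have ne: "?X \<noteq> {}" "?Y \<noteq> {}" using subgroup.one_closed[OF A] subgroup.one_closed[OF B] by blast+
  show ?thesis
  proof (cases "finite ?X \<and> finite ?Y")
    case True
    then show ?thesis unfolding sub_index_eq using fin card by (simp add: card_cartesian_product)
  next
    case False
    then have "infinite ?Z" unfolding fin finite_cartesian_product_iff using ne by blast
    moreover have "sub_index G A B \<noteq> 0" "sub_index G B C \<noteq> 0"
      unfolding sub_index_eq using ne by (auto simp: zero_enat_def)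
    moreover have "sub_index G A B = \<infinity> \<or> sub_index G B C = \<infinity>"
      using False unfolding sub_index_eq by auto
    ultimately show ?thesis unfolding sub_index_eq[of G A C] 
      by (cases "sub_index G A B"; cases "sub_index G B C") (auto simp: zero_enat_def)
  qed
qed

lemma (in group) sub_index_pos:
  assumes "A \<noteq> {}" 
  shows "sub_index G A C \<ge> 1"
  using assms unfolding sub_index_eq by (auto simp: one_enat_def Suc_le_eq card_gt_0_iff)

lemma (in group) sub_index_anti_mono:
  assumes "subgroup A G" "subgroup B G" "subgroup C G" "B \<subseteq> A" "C \<subseteq> B"
  shows "sub_index G A B \<le> sub_index G A C"
proof -
  have "sub_index G A B * 1 \<le> sub_index G A B * sub_index G B C"
    using sub_index_pos[of B C] subgroup.one_closed[OF assms(2)] by (intro mult_left_mono) auto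
  then show ?thesis using sub_index_mult[OF assms] by simp
qed

lemma (in group) sub_index_eq_1_imp:
  assumes A: "subgroup A G" and C: "subgroup C G" and "C \<subseteq> A" and 1: "sub_index G A C \<le> 1"
  shows "A = C"
proof -
  have 1: "finite ((\<lambda>a. C #> a) ` A)" "card ((\<lambda>a. C #> a) ` A) \<le> 1"
    using 1 unfolding sub_index_eq by (auto simp: one_enat_def split: if_splits)
  have "a \<in> C" if a: "a \<in> A" for a
  proof -
    have "\<one> \<in> A" by (rule subgroup.one_closed[OF A])
    moreover have "\<forall>X\<in>(\<lambda>a. C #> a) ` A. \<forall>Y\<in>(\<lambda>a. C #> a) ` A. X = Y"
      using card_le_Suc0_iff_eq[OF 1(1)] 1(2) unfolding One_nat_def by (rule iffD1)
    ultimately have "C #> a = C #> \<one>" using a by blast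
    then show ?thesis using a subgroup.mem_carrier[OF A a] by (simp add: rcos_eq_iff[OF C])
  qed
  then show ?thesis using assms(3) by blast
qed

section \<open>Open and closed subgroups of profinite groups\<close>

context topological_group
begin

lemma openin_subset_carrier: "openin T U \<Longrightarrow> U \<subseteq> carrier G"
  using openin_subset topspace_eq_carrier by blast

lemma continuous_map_mult:
  assumes "continuous_map X T f" "continuous_map X T g"
  shows "continuous_map X T (\<lambda>x. f x \<otimes> g x)"
proof -
  have "continuous_map X (prod_topology T T) (\<lambda>x. (f x, g x))"
    using assms by (simp add: continuous_map_paired)
  from continuous_map_compose[OF this continuous_mult] show ?thesis by (simp add: o_def)
qed

lemma continuous_map_translate:
  assumes "a \<in> carrier G"
  shows "continuous_map T T (\<lambda>x. x \<otimes> a)" "continuous_map T T (\<lambda>x. a \<otimes> x)"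
  using assms topspace_eq_carrier by (auto intro!: continuous_map_mult simp: continuous_map_id[unfolded id_def])

lemma continuous_map_pow: "continuous_map T T (\<lambda>x. x [^] (n::nat))"
proof (induction n)
  case 0 then show ?case using topspace_eq_carrier by simp
next
  case (Suc n) then show ?case
    by (simp add: continuous_map_mult continuous_map_id[unfolded id_def])
qed

lemma rcos_eq_preimage:
  assumes "U \<subseteq> carrier G" "a \<in> carrier G"
  shows "U #> a = {x \<in> topspace T. x \<otimes> inv a \<in> U}"
proof (intro equalityI subsetI)
  fix x assume "x \<in> U #> a"
  then obtain u where "u \<in> U" "x = u \<otimes> a" unfolding r_coset_def by blast
  moreover have "u \<in> carrier G" using calculation assms by blast
  ultimately show "x \<in> {x \<in> topspace T. x \<otimes> inv a \<in> U}"
    using assms by (simp add: topspace_eq_carrier m_assoc)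
next
  fix x assume "x \<in> {x \<in> topspace T. x \<otimes> inv a \<in> U}"
  then have "x \<in> carrier G" "x \<otimes> inv a \<in> U" by (simp_all add: topspace_eq_carrier)
  moreover have "x = (x \<otimes> inv a) \<otimes> a" using calculation assms by (simp add: m_assoc)
  ultimately show "x \<in> U #> a" unfolding r_coset_def by blast
qed

lemma openin_rcos:
  assumes "openin T U" "a \<in> carrier G"
  shows "openin T (U #> a)"
  unfolding rcos_eq_preimage[OF openin_subset_carrier[OF assms(1)] assms(2)]
  by (rule openin_continuous_map_preimage[OF continuous_map_translate(1)[OF inv_closed[OF assms(2)]] assms(1)])

lemma closedin_rcos:
  assumes "closedin T U" "a \<in> carrier G"
  shows "closedin T (U #> a)"
proof -
  have "U \<subseteq> carrier G" using closedin_subset[OF assms(1)] topspace_eq_carrier by simp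
  from rcos_eq_preimage[OF this assms(2)] show ?thesis
    using closedin_continuous_map_preimage[OF continuous_map_translate(1)[OF inv_closed[OF assms(2)]] assms(1)]
    by simp
qed

lemma openin_subgroup_superset:
  assumes H: "subgroup H G" and U: "openin T U" "\<one> \<in> U" "U \<subseteq> H"
  shows "openin T H"
proof -
  have "H = (\<Union>h\<in>H. U #> h)"
  proof (intro equalityI subsetI)
    fix h assume h: "h \<in> H"
    then have "\<one> \<otimes> h \<in> U #> h" using U unfolding r_coset_def by blast
    then show "h \<in> (\<Union>h\<in>H. U #> h)" using h subgroup.mem_carrier[OF H h] by auto
  next
    fix x assume "x \<in> (\<Union>h\<in>H. U #> h)"
    then show "x \<in> H" using U(3) subgroup.m_closed[OF H] unfolding r_coset_def by blast
  qed
  moreover have "openin T (\<Union>h\<in>H. U #> h)"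
    using openin_rcos[OF U(1)] subgroup.mem_carrier[OF H] by (intro openin_Union) blast
  ultimately show ?thesis by simp
qed

lemma Compl_subgroup:
  assumes H: "subgroup H G"
  shows "carrier G - H = \<Union>(rcosets H - {H})"
proof -
  have H_in: "H \<in> rcosets H" by (rule subgroup.subgroup_in_rcosets[OF H is_group])
  have "R \<inter> H = {}" if "R \<in> rcosets H" "R \<noteq> H" for R
    using pairwiseD[OF rcos_disjoint[OF H] that(1) H_in that(2)] unfolding disjnt_def .
  moreover have "carrier G = \<Union>(rcosets H)" using rcosets_part_G[OF H] by simp
  ultimately show ?thesis by blast
qed

lemma closedin_open_subgroup:
  assumes H: "subgroup H G" and "openin T H"
  shows "closedin T H"
proof -
  have "openin T (carrier G - H)"
    unfolding Compl_subgroup[OF H] using openin_rcos[OF assms(2)] by (intro openin_Union) (auto simp: RCOSETS_def)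
  then show ?thesis
    using subgroup.subset[OF H] by (simp add: closedin_def topspace_eq_carrier)
qed

lemma openin_closed_subgroup_finite_index:
  assumes H: "subgroup H G" and "closedin T H" "finite (rcosets H)"
  shows "openin T H"
proof -
  have "closedin T (carrier G - H)"
    unfolding Compl_subgroup[OF H] using closedin_rcos[OF assms(2)] assms(3)
    by (intro closedin_Union) (auto simp: RCOSETS_def)
  then have "openin T (carrier G - (carrier G - H))" by (simp add: closedin_def topspace_eq_carrier)
  then show ?thesis using subgroup.subset[OF H] by (simp add: double_diff)
qed

end

context profinite_group
begin

lemma finite_rcosets_open:
  assumes H: "subgroup H G" and "openin T H"
  shows "finite (rcosets H)"
proof -
  have "\<forall>U\<in>rcosets H. openin T U" using openin_rcos[OF assms(2)] by (auto simp: RCOSETS_def)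
  moreover have "topspace T \<subseteq> \<Union>(rcosets H)" using rcosets_part_G[OF H] topspace_eq_carrier by simp
  ultimately obtain F where F: "finite F" "F \<subseteq> rcosets H" "topspace T \<subseteq> \<Union>F"
    using compact unfolding compact_space_alt by meson
  have "rcosets H \<subseteq> F"
  proof
    fix R assume R: "R \<in> rcosets H"
    then obtain r where r: "r \<in> R" using subgroup.rcosets_non_empty[OF H] by blast
    then have "r \<in> topspace T" using R rcosets_part_G[OF H] topspace_eq_carrier by blast
    then obtain R' where R': "R' \<in> F" "r \<in> R'" using F(3) by blast
    then have "R' = R" using rcos_disjoint[OF H] R r F(2) unfolding pairwise_def disjnt_def by blast
    then show "R \<in> F" using R' by simp
  qed
  then show ?thesis using F(1) finite_subset by blast
qed

text \<open>Every open subgroup contains an open normal one: its normal core is the intersection of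
  its conjugates, and there are only finitely many of these because the index is finite.\<close>
lemma open_normal_core:
  assumes H: "subgroup H G" and oH: "openin T H"
  shows "\<exists>N. open_normal G T N \<and> N \<subseteq> H"
proof -
  define C where "C g = {x \<in> topspace T. g \<otimes> x \<otimes> inv g \<in> H}" for g
  define N where "N = (\<Inter>g\<in>carrier G. C g)"
  have openC: "openin T (C g)" if g: "g \<in> carrier G" for g
  proof -
    have "continuous_map T T (\<lambda>x. g \<otimes> x \<otimes> inv g)"
      using continuous_map_compose[OF continuous_map_translate(2)[OF g] continuous_map_translate(1)[OF inv_closed[OF g]]]
      by (simp add: o_def)
    then show ?thesis unfolding C_def using oH by (rule openin_continuous_map_preimage)
  qed
  have Ceq: "C (h \<otimes> g) = C g" if h: "h \<in> H" and g: "g \<in> carrier G" for h g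
  proof -
    have hc: "h \<in> carrier G" using subgroup.mem_carrier[OF H h] .
    have "(h \<otimes> g \<otimes> x \<otimes> inv (h \<otimes> g) \<in> H) = (g \<otimes> x \<otimes> inv g \<in> H)" if x: "x \<in> carrier G" for x
    proof
      assume "h \<otimes> g \<otimes> x \<otimes> inv (h \<otimes> g) \<in> H"
      then have "inv h \<otimes> (h \<otimes> g \<otimes> x \<otimes> inv (h \<otimes> g)) \<otimes> h \<in> H"
        using h subgroup.m_closed[OF H] subgroup.m_inv_closed[OF H] by presburger
      moreover have "inv h \<otimes> (h \<otimes> g \<otimes> x \<otimes> inv (h \<otimes> g)) \<otimes> h = g \<otimes> x \<otimes> inv g"
        using hc g x by (simp add: m_assoc inv_mult_group)
      ultimately show "g \<otimes> x \<otimes> inv g \<in> H" by simp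
    next
      assume "g \<otimes> x \<otimes> inv g \<in> H"
      then have "h \<otimes> (g \<otimes> x \<otimes> inv g) \<otimes> inv h \<in> H"
        using h subgroup.m_closed[OF H] subgroup.m_inv_closed[OF H] by presburger
      moreover have "h \<otimes> (g \<otimes> x \<otimes> inv g) \<otimes> inv h = h \<otimes> g \<otimes> x \<otimes> inv (h \<otimes> g)"
        using hc g x by (simp add: m_assoc inv_mult_group)
      ultimately show "h \<otimes> g \<otimes> x \<otimes> inv (h \<otimes> g) \<in> H" by simp
    qed
    then show ?thesis unfolding C_def topspace_eq_carrier by blast
  qed
  have "C ` carrier G \<subseteq> (\<lambda>R. C (SOME r. r \<in> R)) ` (rcosets H)"
  proof (rule image_subsetI)
    fix g assume g: "g \<in> carrier G"
    have "(SOME r. r \<in> H #> g) \<in> H #> g" by (rule someI[of "\<lambda>r. r \<in> H #> g", OF rcos_self[OF g H]])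
    then obtain h where "h \<in> H" "(SOME r. r \<in> H #> g) = h \<otimes> g" unfolding r_coset_def by blast
    then have "C g = C (SOME r. r \<in> H #> g)" using Ceq[OF _ g] by metis
    then show "C g \<in> (\<lambda>R. C (SOME r. r \<in> R)) ` (rcosets H)"
      using rcosetsI[OF subgroup.subset[OF H] g] by blast
  qed
  then have "finite (C ` carrier G)" using finite_rcosets_open[OF assms] finite_surj by blast
  then have "openin T N" unfolding N_def using openC one_closed by (intro openin_Inter) blast+
  moreover have NI: "x \<in> N" if "x \<in> carrier G" "\<And>g. g \<in> carrier G \<Longrightarrow> g \<otimes> x \<otimes> inv g \<in> H" for x
    using that unfolding N_def C_def topspace_eq_carrier by blast
  have ND: "x \<in> carrier G" "g \<in> carrier G \<Longrightarrow> g \<otimes> x \<otimes> inv g \<in> H" if "x \<in> N" for x g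
    using that one_closed unfolding N_def C_def topspace_eq_carrier by blast+
  have sub: "subgroup N G"
  proof (rule subgroupI)
    show "N \<subseteq> carrier G" using ND by blast
    have "\<one> \<in> N" by (rule NI) (simp_all add: subgroup.one_closed[OF H])
    then show "N \<noteq> {}" by blast
  next
    fix x assume x: "x \<in> N"
    show "inv x \<in> N"
    proof (rule NI)
      fix g assume g: "g \<in> carrier G"
      have "inv (g \<otimes> x \<otimes> inv g) \<in> H" using ND(2)[OF x g] by (rule subgroup.m_inv_closed[OF H])
      then show "g \<otimes> inv x \<otimes> inv g \<in> H" using g ND(1)[OF x] by (simp add: inv_mult_group m_assoc)
    qed (simp add: ND(1)[OF x])
  next
    fix x y assume x: "x \<in> N" and y: "y \<in> N"
    show "x \<otimes> y \<in> N"
    proof (rule NI)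
      fix g assume g: "g \<in> carrier G"
      have "(g \<otimes> x \<otimes> inv g) \<otimes> (g \<otimes> y \<otimes> inv g) \<in> H" 
        using ND(2)[OF x g] ND(2)[OF y g] by (rule subgroup.m_closed[OF H])
      then show "g \<otimes> (x \<otimes> y) \<otimes> inv g \<in> H" using g ND(1)[OF x] ND(1)[OF y] by (simp add: m_assoc)
    qed (simp add: ND(1)[OF x] ND(1)[OF y])
  qed
  have "N \<lhd> G"
  proof (rule normal_invI[OF sub])
    fix g x assume g: "g \<in> carrier G" and x: "x \<in> N"
    show "g \<otimes> x \<otimes> inv g \<in> N"
    proof (rule NI)
      fix h assume h: "h \<in> carrier G"
      have "(h \<otimes> g) \<otimes> x \<otimes> inv (h \<otimes> g) \<in> H" by (rule ND(2)[OF x]) (simp add: g h)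
      then show "h \<otimes> (g \<otimes> x \<otimes> inv g) \<otimes> inv h \<in> H" 
        using g h ND(1)[OF x] by (simp add: inv_mult_group m_assoc)
    qed (simp add: ND(1)[OF x] g)
  qed
  moreover have "N \<subseteq> H"
  proof
    fix x assume x: "x \<in> N"
    show "x \<in> H" using ND(2)[OF x one_closed] ND(1)[OF x] by simp
  qed
  ultimately show ?thesis unfolding open_normal_def by blast
qed

lemma open_normal_base:
  assumes "openin T U" "\<one> \<in> U"
  shows "\<exists>N. open_normal G T N \<and> N \<subseteq> U"
  using open_subgroup_base[OF assms] open_normal_core by (meson subset_trans)

lemma open_normal_base_translate:
  assumes U: "openin T U" "a \<in> U"
  shows "\<exists>N. open_normal G T N \<and> N #> a \<subseteq> U"
proof -
  have a: "a \<in> carrier G" using assms openin_subset_carrier by blast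
  have "openin T (U #> inv a)" using openin_rcos[OF U(1)] a by simp
  moreover have "\<one> \<in> U #> inv a" using U(2) a unfolding r_coset_def by (auto intro!: bexI[of _ a])
  ultimately obtain N where N: "open_normal G T N" "N \<subseteq> U #> inv a" using open_normal_base by blast
  have "N #> a \<subseteq> U #> inv a #> a" using N(2) unfolding r_coset_def by blast
  also have "\<dots> = U" using openin_subset_carrier[OF U(1)] a by (simp add: coset_mult_assoc)
  finally show ?thesis using N(1) by blast
qed

lemma open_normalD:
  assumes "open_normal G T N"
  shows "N \<lhd> G" "subgroup N G" "openin T N" "closedin T N" "finite (rcosets N)"
  using assms closedin_open_subgroup finite_rcosets_open
  unfolding open_normal_def by (auto dest: normal_imp_subgroup)

text \<open>The closure of \<open>S\<close> is the intersection of the products \<open>N S\<close> over all open normal subgroups \<open>N\<close>.\<close>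
lemma in_closure_iff:
  assumes S: "S \<subseteq> carrier G"
  shows "x \<in> T closure_of S \<longleftrightarrow> x \<in> carrier G \<and> (\<forall>N. open_normal G T N \<longrightarrow> (\<exists>s\<in>S. x \<otimes> inv s \<in> N))"
    (is "_ \<longleftrightarrow> ?R")
proof
  assume x: "x \<in> T closure_of S"
  then have xc: "x \<in> carrier G" unfolding in_closure_of topspace_eq_carrier by blast
  have "\<exists>s\<in>S. x \<otimes> inv s \<in> N" if N: "open_normal G T N" for N
  proof -
    note N' = open_normalD[OF N]
    have "openin T (N #> x)" by (rule openin_rcos[OF N'(3) xc])
    moreover have "x \<in> N #> x" by (rule rcos_self[OF xc N'(2)])
    ultimately obtain s where s: "s \<in> S" "s \<in> N #> x" using x unfolding in_closure_of by blast
    have sc: "s \<in> carrier G" using s S by blast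
    have "s \<otimes> inv x \<in> N" using s(2) subgroup.rcos_module[OF N'(2) is_group xc sc] by blast
    then have "inv (s \<otimes> inv x) \<in> N" by (rule subgroup.m_inv_closed[OF N'(2)])
    then show ?thesis using s(1) sc xc by (intro bexI[of _ s]) (simp_all add: inv_mult_group)
  qed
  then show ?R using xc by blast
next
  assume R: ?R
  show "x \<in> T closure_of S" unfolding in_closure_of topspace_eq_carrier
  proof (intro conjI allI impI)
    show "x \<in> carrier G" using R by blast
  next
    fix U assume "x \<in> U \<and> openin T U"
    then obtain N where N: "open_normal G T N" "N #> x \<subseteq> U" using open_normal_base_translate by blast
    note N' = open_normalD[OF N(1)]
    obtain s where s: "s \<in> S" "x \<otimes> inv s \<in> N" using R N(1) by blast
    have c: "s \<in> carrier G" "x \<in> carrier G" using s S R by blast+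
    have "inv (x \<otimes> inv s) \<in> N" using s(2) by (rule subgroup.m_inv_closed[OF N'(2)])
    then have "s \<otimes> inv x \<in> N" using c by (simp add: inv_mult_group)
    then have "s \<in> N #> x" by (rule subgroup.rcos_module_rev[OF N'(2) is_group c(2,1)])
    then show "\<exists>y. y \<in> S \<and> y \<in> U" using s(1) N(2) by blast
  qed
qed

lemma subgroup_closure:
  assumes S: "subgroup S G"
  shows "subgroup (T closure_of S) G"
proof -
  have Sc: "S \<subseteq> carrier G" by (rule subgroup.subset[OF S])
  note iff = in_closure_iff[OF Sc]
  show ?thesis
  proof (rule subgroupI)
    show "T closure_of S \<subseteq> carrier G" using closure_of_subset_topspace topspace_eq_carrier by metis
    have "S \<subseteq> T closure_of S" using Sc by (intro closure_of_subset) (simp add: topspace_eq_carrier)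
    then show "T closure_of S \<noteq> {}" using subgroup.one_closed[OF S] by blast
  next
    fix x assume x: "x \<in> T closure_of S"
    then have xc: "x \<in> carrier G" unfolding iff by blast
    show "inv x \<in> T closure_of S" unfolding iff
    proof (intro conjI allI impI)
      fix N assume N: "open_normal G T N"
      note N' = open_normalD[OF N]
      obtain s where s: "s \<in> S" "x \<otimes> inv s \<in> N" using x N unfolding iff by blast
      have sc: "s \<in> carrier G" using s Sc by blast
      have "inv x \<otimes> inv (x \<otimes> inv s) \<otimes> inv (inv x) \<in> N"
        by (rule normal.inv_op_closed2[OF N'(1) _ subgroup.m_inv_closed[OF N'(2) s(2)]]) (simp add: xc)
      then have "inv x \<otimes> inv (inv s) \<in> N" using xc sc by (simp add: inv_mult_group m_assoc)
      then show "\<exists>s\<in>S. inv x \<otimes> inv s \<in> N" using subgroup.m_inv_closed[OF S s(1)] by blast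
    qed (simp add: xc)
  next
    fix x y assume x: "x \<in> T closure_of S" and y: "y \<in> T closure_of S"
    then have xc: "x \<in> carrier G" "y \<in> carrier G" unfolding iff by blast+
    show "x \<otimes> y \<in> T closure_of S" unfolding iff
    proof (intro conjI allI impI)
      fix N assume N: "open_normal G T N"
      note N' = open_normalD[OF N]
      obtain s where s: "s \<in> S" "x \<otimes> inv s \<in> N" using x N unfolding iff by blast
      obtain t where t: "t \<in> S" "y \<otimes> inv t \<in> N" using y N unfolding iff by blast
      have c: "s \<in> carrier G" "t \<in> carrier G" using s t Sc by blast+
      have "(x \<otimes> (y \<otimes> inv t) \<otimes> inv x) \<otimes> (x \<otimes> inv s) \<in> N"
        by (rule subgroup.m_closed[OF N'(2) normal.inv_op_closed2[OF N'(1) xc(1) t(2)] s(2)])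
      then have "x \<otimes> y \<otimes> inv (s \<otimes> t) \<in> N" using xc c by (simp add: inv_mult_group m_assoc)
      then show "\<exists>s\<in>S. x \<otimes> y \<otimes> inv s \<in> N" using subgroup.m_closed[OF S s(1) t(1)] by blast
    qed (simp add: xc)
  qed
qed

lemma normal_closure:
  assumes S: "S \<lhd> G"
  shows "T closure_of S \<lhd> G"
proof (rule normal_invI[OF subgroup_closure[OF normal_imp_subgroup[OF S]]])
  have Sc: "S \<subseteq> carrier G" by (rule subgroup.subset[OF normal_imp_subgroup[OF S]])
  note iff = in_closure_iff[OF Sc]
  fix g x assume g: "g \<in> carrier G" and x: "x \<in> T closure_of S"
  then have xc: "x \<in> carrier G" unfolding iff by blast
  show "g \<otimes> x \<otimes> inv g \<in> T closure_of S" unfolding iff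
  proof (intro conjI allI impI)
    fix N assume N: "open_normal G T N"
    note N' = open_normalD[OF N]
    obtain s where s: "s \<in> S" "x \<otimes> inv s \<in> N" using x N unfolding iff by blast
    have sc: "s \<in> carrier G" using s Sc by blast
    have "g \<otimes> (x \<otimes> inv s) \<otimes> inv g \<in> N" by (rule normal.inv_op_closed2[OF N'(1) g s(2)])
    then have "g \<otimes> x \<otimes> inv g \<otimes> inv (g \<otimes> s \<otimes> inv g) \<in> N"
      using g xc sc by (simp add: inv_mult_group m_assoc)
    then show "\<exists>s\<in>S. g \<otimes> x \<otimes> inv g \<otimes> inv s \<in> N" using normal.inv_op_closed2[OF S g s(1)] by blast
  qed (simp add: xc g)
qed

text \<open>For normal \<open>H\<close>, \<open>commutator_subgroup G T H (carrier G)\<close> is the least closed subgroup containing all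
  commutators of elements of \<open>H\<close>, and it is normal.\<close>
lemma commutator_subgroup_props:
  assumes H: "H \<lhd> G"
  defines "C \<equiv> commutator_subgroup G T H (carrier G)"
  shows "C \<lhd> G" "closedin T C"
    and "\<And>h g. \<lbrakk>h \<in> H; g \<in> carrier G\<rbrakk> \<Longrightarrow> comm h g \<in> C"
    and "\<And>S. \<lbrakk>subgroup S G; closedin T S; \<And>h g. \<lbrakk>h \<in> H; g \<in> carrier G\<rbrakk> \<Longrightarrow> comm h g \<in> S\<rbrakk> \<Longrightarrow> C \<subseteq> S"
proof -
  define X where "X = {h \<otimes> k \<otimes> inv h \<otimes> inv k | h k. h \<in> H \<and> k \<in> carrier G}"
  have C: "C = T closure_of generate G X" unfolding C_def commutator_subgroup_def X_def ..
  have Hc: "h \<in> carrier G" if "h \<in> H" for h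
    using subgroup.mem_carrier[OF normal_imp_subgroup[OF H] that] .
  have Xc: "X \<subseteq> carrier G" unfolding X_def using Hc by blast
  have nX: "generate G X \<lhd> G"
  proof (rule normal_generateI[OF Xc])
    fix y g assume y: "y \<in> X" and g: "g \<in> carrier G"
    then obtain h k where h: "h \<in> H" "k \<in> carrier G" "y = h \<otimes> k \<otimes> inv h \<otimes> inv k"
      unfolding X_def by blast
    have "g \<otimes> y \<otimes> inv g = comm (g \<otimes> h \<otimes> inv g) (g \<otimes> k \<otimes> inv g)"
      using h g Hc by (simp add: m_assoc inv_mult_group)
    then show "g \<otimes> y \<otimes> inv g \<in> X"
      unfolding X_def using normal.inv_op_closed2[OF H g h(1)] g h(2) by blast
  qed
  show "C \<lhd> G" unfolding C by (rule normal_closure[OF nX])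
  show "closedin T C" unfolding C by (rule closedin_closure_of)
  have "generate G X \<subseteq> C" unfolding C using subgroup.subset[OF normal_imp_subgroup[OF nX]]
    by (intro closure_of_subset) (simp add: topspace_eq_carrier)
  then show "comm h g \<in> C" if "h \<in> H" "g \<in> carrier G" for h g
    using that generate.incl[of _ X G] unfolding X_def by blast
  show "C \<subseteq> S" if "subgroup S G" "closedin T S" "\<And>h g. \<lbrakk>h \<in> H; g \<in> carrier G\<rbrakk> \<Longrightarrow> comm h g \<in> S" for S
    unfolding C
  proof (rule closure_of_minimal[OF _ that(2)])
    show "generate G X \<subseteq> S"
      by (rule generate_subgroup_incl[OF _ that(1)]) (use that(3) in \<open>auto simp: X_def\<close>)
  qed
qed

end

section \<open>The lower central series and obliquity subgroups\<close>

text \<open>Without this declaration the simplifier unfolds later terms of the series into earlier ones.\<close>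
declare lower_central.simps(3) [simp del]

context profinite_group
begin

text \<open>The lower central series with indices shifted so that it starts at zero, avoiding the
  dummy value.\<close>
abbreviation lc :: "nat \<Rightarrow> 'a set" where
  "lc i \<equiv> lower_central G T (Suc i)"

lemma lc_closed_normal: "lc i \<lhd> G \<and> closedin T (lc i)"
proof (induction i)
  case 0 then show ?case using carrier_normal closedin_topspace[of T] by (simp add: topspace_eq_carrier)
next
  case (Suc i) then show ?case using commutator_subgroup_props(1,2)[of "lc i"] by (simp add: lower_central.simps(3))
qed

lemmas lc_normal = lc_closed_normal[THEN conjunct1]
  and lc_closed = lc_closed_normal[THEN conjunct2]
  and lc_subgroup = lc_closed_normal[THEN conjunct1, THEN normal_imp_subgroup]

lemma comm_in_lc: "\<lbrakk>h \<in> lc i; g \<in> carrier G\<rbrakk> \<Longrightarrow> comm h g \<in> lc (Suc i)"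
  using commutator_subgroup_props(3)[OF lc_normal] by (simp add: lower_central.simps(3))

lemma lc_Suc_minimal:
  assumes "subgroup S G" "closedin T S" "\<And>h g. \<lbrakk>h \<in> lc i; g \<in> carrier G\<rbrakk> \<Longrightarrow> comm h g \<in> S"
  shows "lc (Suc i) \<subseteq> S"
  using commutator_subgroup_props(4)[OF lc_normal assms] by (simp add: lower_central.simps(3))

lemma lc_Suc_subset: "lc (Suc i) \<subseteq> lc i"
proof (rule lc_Suc_minimal[OF lc_subgroup lc_closed])
  fix h g assume h: "h \<in> lc i" and g: "g \<in> carrier G"
  have hc: "h \<in> carrier G" using subgroup.mem_carrier[OF lc_subgroup h] .
  have "h \<otimes> (g \<otimes> inv h \<otimes> inv g) \<in> lc i"
    by (rule subgroup.m_closed[OF lc_subgroup h normal.inv_op_closed2[OF lc_normal g subgroup.m_inv_closed[OF lc_subgroup h]]])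
  then show "comm h g \<in> lc i" using g hc by (simp add: m_assoc)
qed

lemma lc_antimono: "i \<le> j \<Longrightarrow> lc j \<subseteq> lc i"
  using lift_Suc_antimono_le[of lc i j] lc_Suc_subset by blast

lemma Ob_mono: "H \<subseteq> I \<Longrightarrow> Ob G T H \<subseteq> Ob G T I"
  unfolding Ob_def by blast

lemma Ob_subset: "Ob G T H \<subseteq> H"
  unfolding Ob_def by blast

lemma Ob_subset_open_normal:
  "\<lbrakk>open_normal G T K; \<not> K \<subseteq> H\<rbrakk> \<Longrightarrow> Ob G T H \<subseteq> K"
  unfolding Ob_def by blast

lemma Ob_closed_normal:
  assumes "H \<lhd> G" "closedin T H"
  shows "Ob G T H \<lhd> G" "closedin T (Ob G T H)"
proof -
  let ?F = "insert H {K. open_normal G T K \<and> \<not> K \<subseteq> H}"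
  have "Ob G T H = \<Inter>?F" unfolding Ob_def by simp
  moreover have "N \<lhd> G \<and> closedin T N" if "N \<in> ?F" for N using that assms open_normalD by blast
  ultimately show "Ob G T H \<lhd> G" "closedin T (Ob G T H)"
    using normal_Inter[of ?F] closedin_Inter[of ?F T] by auto
qed

lemma open_normal_carrier: "open_normal G T (carrier G)"
  using carrier_normal openin_topspace[of T] unfolding open_normal_def topspace_eq_carrier by simp

lemma sub_index_self:
  assumes "subgroup H G"
  shows "sub_index G H H = 1"
proof -
  have "(\<lambda>a. H #> a) ` H = {H}"
    using subgroup.rcos_const[OF assms is_group] subgroup.one_closed[OF assms] by blast
  then show ?thesis unfolding sub_index_eq by (simp add: one_enat_def)
qed

lemma normal_core_upto_closed_normal:
  assumes "n > 0"
  shows "normal_core_upto G T n \<lhd> G" "closedin T (normal_core_upto G T n)"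
proof -
  let ?F = "{N. open_normal G T N \<and> group_index G N \<le> enat n}"
  have "group_index G (carrier G) \<le> enat n"
    unfolding group_index_def sub_index_self[OF subgroup_self] using assms by (simp add: one_enat_def)
  then have "carrier G \<in> ?F" using open_normal_carrier by simp
  then have "?F \<noteq> {}" by blast
  moreover have "N \<lhd> G \<and> closedin T N" if "N \<in> ?F" for N using that open_normalD by blast
  ultimately show "normal_core_upto G T n \<lhd> G" "closedin T (normal_core_upto G T n)"
    unfolding normal_core_upto_def using normal_Inter[of ?F] closedin_Inter[of ?F T] by blast+
qed

lemma normal_core_upto_subset:
  "\<lbrakk>open_normal G T N; group_index G N \<le> enat n\<rbrakk> \<Longrightarrow> normal_core_upto G T n \<subseteq> N"
  unfolding normal_core_upto_def by blast

lemma open_normal_superset: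
  assumes "open_normal G T N" "K \<lhd> G" "N \<subseteq> K"
  shows "open_normal G T K"
  using openin_subgroup_superset[OF normal_imp_subgroup[OF assms(2)], of N] open_normalD[OF assms(1)]
    subgroup.one_closed assms unfolding open_normal_def by blast

lemma closed_normal_finite_index:
  assumes "N \<lhd> G" "closedin T N" "group_index G N < \<infinity>"
  shows "open_normal G T N"
proof -
  have "rcosets N = (\<lambda>a. N #> a) ` carrier G" by (auto simp: RCOSETS_def)
  then have "finite (rcosets N)" using assms(3) unfolding group_index_def sub_index_eq by (auto split: if_splits)
  then show ?thesis
    using openin_closed_subgroup_finite_index[OF normal_imp_subgroup[OF assms(1)] assms(2)] assms(1)
    unfolding open_normal_def by blast
qed

lemma group_index_open_normal:
  assumes "open_normal G T N"
  shows "group_index G N = enat (card (rcosets N))" 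
proof -
  have "rcosets N = (\<lambda>a. N #> a) ` carrier G" by (auto simp: RCOSETS_def)
  then show ?thesis using open_normalD(5)[OF assms] unfolding group_index_def sub_index_eq by simp
qed

end

context pro_p_group
begin

text \<open>Since the finite quotients are \<open>p\<close>-groups, an open normal subgroup \<open>N\<close> that is properly contained in an
  open normal subgroup \<open>H\<close> can be enlarged within \<open>H\<close> to some \<open>Z\<close> such that \<open>Z / N\<close> is central.\<close>
lemma open_normal_central_step:
  assumes p: "prime p" and N: "open_normal G T N" and H: "H \<lhd> G" and NH: "N \<subseteq> H" "N \<noteq> H"
  shows "\<exists>Z. open_normal G T Z \<and> N \<subset> Z \<and> Z \<subseteq> H \<and> (\<forall>z\<in>Z. \<forall>g\<in>carrier G. comm z g \<in> N)"
proof -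
  note N' = open_normalD[OF N]
  note hom = normal.group_hom_Mod[OF N'(1)]
  have H': "subgroup H G" by (rule normal_imp_subgroup[OF H])
  have Hc: "h \<in> carrier G" if "h \<in> H" for h using subgroup.mem_carrier[OF H' that] .
  let ?Q = "G Mod N"
  obtain k where "group_index G N = enat (p ^ k)" using index_prime_power[OF N] by blast
  then have ord: "Coset.order ?Q = p ^ k"
    unfolding group_index_open_normal[OF N] by (simp add: Coset.order_def FactGroup_def)
  have HQ: "(\<lambda>a. N #> a) ` H \<lhd> ?Q"
    by (rule normal.surj_hom_normal_subgroup[OF H hom]) (simp add: carrier_FactGroup)
  have "(\<lambda>a. N #> a) ` H \<noteq> {\<one>\<^bsub>?Q\<^esub>}"
  proof
    assume eq: "(\<lambda>a. N #> a) ` H = {\<one>\<^bsub>?Q\<^esub>}"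
    have "h \<in> N" if "h \<in> H" for h
    proof -
      have "N #> h = N" using eq that by auto
      then show ?thesis using normal.rcos_eq_self_iff[OF N'(1) Hc[OF that]] by blast
    qed
    then show False using NH by blast
  qed
  from group.p_group_normal_meets_center[OF normal.factorgroup_is_group[OF N'(1)] p ord HQ this]
  obtain z where z: "z \<in> H" "N #> z \<noteq> N"
    and zc: "\<And>q. q \<in> carrier ?Q \<Longrightarrow> q \<otimes>\<^bsub>?Q\<^esub> (N #> z) = (N #> z) \<otimes>\<^bsub>?Q\<^esub> q" by auto
  define Z where "Z = {x \<in> H. \<forall>g\<in>carrier G. comm x g \<in> N}"
  have zZ: "comm z g \<in> N" if g: "g \<in> carrier G" for g
  proof -
    have "(N #> z) \<otimes>\<^bsub>?Q\<^esub> (N #> g) = (N #> g) \<otimes>\<^bsub>?Q\<^esub> (N #> z)"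
      using zc[of "N #> g"] g by (simp add: carrier_FactGroup)
    then have "N #> (z \<otimes> g) = N #> (g \<otimes> z)"
      using group_hom.hom_mult[OF hom Hc[OF z(1)] g] group_hom.hom_mult[OF hom g Hc[OF z(1)]] by simp
    then have "z \<otimes> g \<otimes> inv (g \<otimes> z) \<in> N" using rcos_eq_iff[OF N'(2)] g Hc[OF z(1)] by simp
    then show ?thesis using g Hc[OF z(1)] by (simp add: m_assoc inv_mult_group)
  qed
  have NZ: "N \<subseteq> Z"
  proof
    fix n assume n: "n \<in> N"
    have nc: "n \<in> carrier G" using n NH Hc by blast
    have "comm n g \<in> N" if g: "g \<in> carrier G" for g
    proof -
      have "n \<otimes> (g \<otimes> inv n \<otimes> inv g) \<in> N"
        by (rule subgroup.m_closed[OF N'(2) n normal.inv_op_closed2[OF N'(1) g subgroup.m_inv_closed[OF N'(2) n]]])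
      then show ?thesis using g nc by (simp add: m_assoc)
    qed
    then show "n \<in> Z" unfolding Z_def using n NH by blast
  qed
  have "subgroup Z G"
  proof (rule subgroupI)
    show "Z \<subseteq> carrier G" unfolding Z_def using Hc by blast
    show "Z \<noteq> {}" using NZ subgroup.one_closed[OF N'(2)] by blast
  next
    fix x assume "x \<in> Z"
    then have x: "x \<in> H" "\<And>g. g \<in> carrier G \<Longrightarrow> comm x g \<in> N" unfolding Z_def by blast+
    have "comm (inv x) g \<in> N" if g: "g \<in> carrier G" for g
    proof -
      have "inv x \<otimes> inv (comm x g) \<otimes> x \<in> N"
        by (rule normal.inv_op_closed1[OF N'(1) Hc[OF x(1)] subgroup.m_inv_closed[OF N'(2) x(2)[OF g]]])
      then show ?thesis using g Hc[OF x(1)] by (simp add: m_assoc inv_mult_group)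
    qed
    then show "inv x \<in> Z" unfolding Z_def using subgroup.m_inv_closed[OF H' x(1)] by blast
  next
    fix x y assume "x \<in> Z" "y \<in> Z"
    then have x: "x \<in> H" "\<And>g. g \<in> carrier G \<Longrightarrow> comm x g \<in> N"
      and y: "y \<in> H" "\<And>g. g \<in> carrier G \<Longrightarrow> comm y g \<in> N" unfolding Z_def by blast+
    have "comm (x \<otimes> y) g \<in> N" if g: "g \<in> carrier G" for g
    proof -
      have "(x \<otimes> comm y g \<otimes> inv x) \<otimes> comm x g \<in> N"
        by (rule subgroup.m_closed[OF N'(2) normal.inv_op_closed2[OF N'(1) Hc[OF x(1)] y(2)[OF g]] x(2)[OF g]])
      then show ?thesis using g Hc[OF x(1)] Hc[OF y(1)] by (simp add: m_assoc inv_mult_group)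
    qed
    then show "x \<otimes> y \<in> Z" unfolding Z_def using subgroup.m_closed[OF H' x(1) y(1)] by blast
  qed
  then have "Z \<lhd> G"
  proof (rule normal_invI)
    fix h x assume h: "h \<in> carrier G" and "x \<in> Z"
    then have x: "x \<in> H" "\<And>g. g \<in> carrier G \<Longrightarrow> comm x g \<in> N" unfolding Z_def by blast+
    have "comm (h \<otimes> x \<otimes> inv h) g \<in> N" if g: "g \<in> carrier G" for g
    proof -
      have "h \<otimes> comm x (inv h \<otimes> g \<otimes> h) \<otimes> inv h \<in> N"
        by (rule normal.inv_op_closed2[OF N'(1) h x(2)]) (simp add: g h)
      then show ?thesis using g h Hc[OF x(1)] by (simp add: m_assoc inv_mult_group)
    qed
    then show "h \<otimes> x \<otimes> inv h \<in> Z" unfolding Z_def using normal.inv_op_closed2[OF H h x(1)] by blast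
  qed
  then have "open_normal G T Z" using open_normal_superset[OF N _ NZ] by blast
  moreover have "z \<in> Z" "z \<notin> N"
    using zZ z normal.rcos_eq_self_iff[OF N'(1) Hc[OF z(1)]] unfolding Z_def by blast+
  ultimately show ?thesis using NZ unfolding Z_def by blast
qed

text \<open>Starting from a term contained in \<open>H\<close>, the lower central series reaches \<open>N\<close> within \<open>|H : N| - 1\<close> further
  steps, since each central enlargement of \<open>N\<close> inside \<open>H\<close> lowers the index and costs one commutator step.
  The bound is crude, but it depends on the index only.\<close>
lemma lc_subset_of_index:
  assumes p: "prime p" and H: "subgroup H G" "H \<lhd> G" and i: "lc i \<subseteq> H"
  shows "\<lbrakk>open_normal G T N; N \<subseteq> H; sub_index G H N \<le> enat (Suc c)\<rbrakk> \<Longrightarrow> lc (i + c) \<subseteq> N"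
proof (induction c arbitrary: N)
  case 0
  then have "H = N" using sub_index_eq_1_imp[OF H(1) open_normalD(2)[OF 0(1)]] by (simp add: one_enat_def)
  then show ?case using i by simp
next
  case (Suc c)
  note N' = open_normalD[OF Suc.prems(1)]
  show ?case
  proof (cases "N = H")
    case True
    then show ?thesis using i lc_antimono[of i "i + Suc c"] by simp
  next
    case False
    obtain Z where Z: "open_normal G T Z" "N \<subset> Z" "Z \<subseteq> H" "\<And>z g. \<lbrakk>z \<in> Z; g \<in> carrier G\<rbrakk> \<Longrightarrow> comm z g \<in> N"
      using open_normal_central_step[OF p Suc.prems(1) H(2) Suc.prems(2) False] by blast
    note Z' = open_normalD[OF Z(1)]
    have mult: "sub_index G H N = sub_index G H Z * sub_index G Z N"
      using sub_index_mult[OF H(1) Z'(2) N'(2) Z(3)] Z(2) by blast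
    have "\<not> sub_index G Z N \<le> 1" using sub_index_eq_1_imp[OF Z'(2) N'(2)] Z(2) by blast
    moreover have "sub_index G H Z \<noteq> 0"
      using sub_index_pos[of H Z] subgroup.one_closed[OF H(1)] by force
    ultimately have "sub_index G H Z \<le> enat (Suc c)"
      using Suc.prems(3) unfolding mult
    proof (cases "sub_index G H Z"; cases "sub_index G Z N")
      fix a b assume ab: "sub_index G H Z = enat a" "sub_index G Z N = enat b"
        and *: "\<not> sub_index G Z N \<le> 1" "sub_index G H Z * sub_index G Z N \<le> enat (Suc (Suc c))"
      have b: "2 \<le> b" and ab': "a * b \<le> Suc (Suc c)" using * unfolding ab by (auto simp: one_enat_def)
      have "a * 2 \<le> a * b" using b by simp
      then have "a \<le> Suc c" using ab' by linarith
      then show ?thesis using ab by simp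
    qed (auto simp: zero_enat_def one_enat_def)
    then have IH: "lc (i + c) \<subseteq> Z" using Suc.IH[OF Z(1,3)] by blast
    have "lc (Suc (i + c)) \<subseteq> N"
      by (rule lc_Suc_minimal[OF N'(2,4)]) (use IH Z(4) in blast)
    then show ?thesis by simp
  qed
qed

lemma lc_eventually_subset:
  assumes p: "prime p" and N: "open_normal G T N"
  shows "\<exists>j. lc j \<subseteq> N"
proof -
  obtain k where k: "group_index G N = enat k" using group_index_open_normal[OF N] by blast
  have "lc (0 + k) \<subseteq> N"
    by (rule lc_subset_of_index[OF p subgroup_self carrier_normal _ N])
       (use k subgroup.subset[OF open_normalD(2)[OF N]] in \<open>auto simp: group_index_def\<close>)
  then show ?thesis by blast
qed

end

section \<open>Factors of the lower central series\<close>

lemma (in normal) comm_pow_left_Mod: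
  assumes h: "h \<in> carrier G" and g: "g \<in> carrier G"
    and central: "\<And>z. z \<in> carrier G \<Longrightarrow> comm (comm h g) z \<in> H"
  shows "H #> comm (h [^] (n::nat)) g = H #> (comm h g [^] n)"
proof -
  note hom = group_hom_Mod
  let ?Q = "G Mod H"
  interpret Q: group ?Q by (rule factorgroup_is_group)
  have Qc: "H #> a \<in> carrier ?Q" if "a \<in> carrier G" for a
    using that by (auto simp: carrier_FactGroup)
  have hm: "H #> (a \<otimes> b) = (H #> a) \<otimes>\<^bsub>?Q\<^esub> (H #> b)" if "a \<in> carrier G" "b \<in> carrier G" for a b
    using group_hom.hom_mult[OF hom that] .
  have hi: "H #> inv a = inv\<^bsub>?Q\<^esub> (H #> a)" if "a \<in> carrier G" for a
    using group_hom.hom_inv[OF hom that] .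
  have hc: "H #> comm a b = Q.comm (H #> a) (H #> b)" if "a \<in> carrier G" "b \<in> carrier G" for a b
    using that hm[of "a \<otimes> b \<otimes> inv a" "inv b"] hm[of "a \<otimes> b" "inv a"] hm[of a b] hi by simp
  have "Q.comm ((H #> h) [^]\<^bsub>?Q\<^esub> n) (H #> g) = Q.comm (H #> h) (H #> g) [^]\<^bsub>?Q\<^esub> n"
  proof (rule Q.comm_pow_left[OF Qc[OF h] Qc[OF g]])
    fix q assume "q \<in> carrier ?Q"
    then obtain z where z: "z \<in> carrier G" "q = H #> z" by (auto simp: carrier_FactGroup)
    let ?c = "comm h g"
    have c: "?c \<in> carrier G" using h g by simp
    have "?c \<otimes> z \<otimes> inv (z \<otimes> ?c) \<in> H" using central[OF z(1)] c z(1) by (simp add: m_assoc inv_mult_group)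
    then have "H #> (?c \<otimes> z) = H #> (z \<otimes> ?c)"
      using rcos_eq_iff[OF subgroup_axioms] c z(1) by simp
    then show "Q.comm (H #> h) (H #> g) \<otimes>\<^bsub>?Q\<^esub> q = q \<otimes>\<^bsub>?Q\<^esub> Q.comm (H #> h) (H #> g)"
      unfolding z(2) hc[OF h g, symmetric] hm[OF c z(1)] hm[OF z(1) c] .
  qed
  then show ?thesis using hc[of "h [^] n" g] FactGroup_pow[of h n] FactGroup_pow[of "comm h g" n] hc[OF h g] h g by simp
qed

lemma (in group) subgroup_nat_pow_closed:
  assumes "subgroup H G" "x \<in> H"
  shows "x [^] (n::nat) \<in> H"
  by (induction n) (use assms subgroup.one_closed subgroup.m_closed in auto)

context profinite_group
begin

lemma comm_lc_central:
  assumes "y \<in> lc i" "g \<in> carrier G"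
  shows "lc (Suc i) #> (y \<otimes> g) = lc (Suc i) #> (g \<otimes> y)"
proof -
  have yc: "y \<in> carrier G" using subgroup.mem_carrier[OF lc_subgroup assms(1)] .
  have "y \<otimes> g \<otimes> inv (g \<otimes> y) \<in> lc (Suc i)"
    using comm_in_lc[OF assms] yc assms(2) by (simp add: m_assoc inv_mult_group)
  then show ?thesis using rcos_eq_iff[OF lc_subgroup] yc assms(2) by simp
qed

text \<open>The index of the commutator subgroup annihilates all factors of the lower central series. In the
  induction, \<open>comm h g [^] d\<close> equals \<open>comm (h [^] d) g\<close> modulo the next but one term; the bound passes from
  commutators to the subgroup that they generate topologically because the elements satisfying it form an open, hence closed,
  subgroup.\<close>
lemma lc_factor_exponent:
  assumes op: "\<And>i. openin T (lc i)" and x: "x \<in> lc i"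
  shows "x [^] card (rcosets (lc 1)) \<in> lc (Suc i)"
  using x
proof (induction i arbitrary: x)
  case 0
  have "finite (rcosets (lc 1))" by (rule finite_rcosets_open[OF lc_subgroup op])
  then show ?case using normal.pow_index_mem[OF lc_normal, of 1 x] 0 by simp
next
  case (Suc i)
  let ?d = "card (rcosets (lc 1))" and ?N = "lc (Suc (Suc i))"
  have N: "?N \<lhd> G" by (rule lc_normal)
  note hom = normal.group_hom_Mod[OF N]
  interpret Q: group "G Mod ?N" by (rule normal.factorgroup_is_group[OF N])
  define S where "S = {y \<in> lc (Suc i). y [^] ?d \<in> ?N}"
  have lcc: "y \<in> carrier G" if "y \<in> lc j" for y j using subgroup.mem_carrier[OF lc_subgroup that] .
  have sub: "subgroup S G"
  proof (rule subgroupI)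
    show "S \<subseteq> carrier G" unfolding S_def using lcc by blast
    have "\<one> \<in> S" unfolding S_def using subgroup.one_closed[OF lc_subgroup] by simp
    then show "S \<noteq> {}" by blast
  next
    fix y assume "y \<in> S"
    then have y: "y \<in> lc (Suc i)" "y [^] ?d \<in> ?N" unfolding S_def by blast+
    have "inv (y [^] ?d) \<in> ?N" using y(2) by (rule subgroup.m_inv_closed[OF lc_subgroup])
    then have "inv y [^] ?d \<in> ?N" using nat_pow_inv[OF lcc[OF y(1)]] by simp
    then show "inv y \<in> S" unfolding S_def using subgroup.m_inv_closed[OF lc_subgroup y(1)] by blast
  next
    fix y z assume "y \<in> S" "z \<in> S"
    then have y: "y \<in> lc (Suc i)" "y [^] ?d \<in> ?N" and z: "z \<in> lc (Suc i)" "z [^] ?d \<in> ?N"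
      unfolding S_def by blast+
    note c = lcc[OF y(1)] lcc[OF z(1)]
    have Qc: "?N #> y \<in> carrier (G Mod ?N)" "?N #> z \<in> carrier (G Mod ?N)"
      using c by (auto simp: carrier_FactGroup)
    have "(?N #> y) \<otimes>\<^bsub>G Mod ?N\<^esub> (?N #> z) = (?N #> z) \<otimes>\<^bsub>G Mod ?N\<^esub> (?N #> y)"
      using comm_lc_central[OF y(1) c(2)] group_hom.hom_mult[OF hom c] group_hom.hom_mult[OF hom c(2,1)] by simp
    from Q.pow_mult_distrib[OF this Qc, of ?d]
    have "?N #> ((y \<otimes> z) [^] ?d) = (?N #> (y [^] ?d)) \<otimes>\<^bsub>G Mod ?N\<^esub> (?N #> (z [^] ?d))"
      by (simp only: group_hom.hom_mult[OF hom c, symmetric] normal.FactGroup_pow[OF N] c m_closed)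
    also have "?N #> (y [^] ?d) = \<one>\<^bsub>G Mod ?N\<^esub>"
      using iffD2[OF normal.rcos_eq_self_iff[OF N nat_pow_closed[OF c(1)]] y(2)] by simp
    also have "?N #> (z [^] ?d) = \<one>\<^bsub>G Mod ?N\<^esub>"
      using iffD2[OF normal.rcos_eq_self_iff[OF N nat_pow_closed[OF c(2)]] z(2)] by simp
    finally have "?N #> ((y \<otimes> z) [^] ?d) = ?N" by (metis Q.l_one Q.one_closed one_FactGroup)
    then have "(y \<otimes> z) [^] ?d \<in> ?N" using normal.rcos_eq_self_iff[OF N] c by simp
    then show "y \<otimes> z \<in> S" unfolding S_def using subgroup.m_closed[OF lc_subgroup y(1) z(1)] by blast
  qed
  have "?N \<subseteq> S"
    unfolding S_def using lc_Suc_subset subgroup_nat_pow_closed[OF lc_subgroup] by blast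
  then have "openin T S"
    using openin_subgroup_superset[OF sub op] subgroup.one_closed[OF lc_subgroup] by blast
  then have cl: "closedin T S" by (rule closedin_open_subgroup[OF sub])
  have "lc (Suc i) \<subseteq> S"
  proof (rule lc_Suc_minimal[OF sub cl])
    fix h g assume h: "h \<in> lc i" and g: "g \<in> carrier G"
    have c: "comm h g \<in> lc (Suc i)" by (rule comm_in_lc[OF h g])
    have "?N #> comm (h [^] ?d) g = ?N #> (comm h g [^] ?d)"
      by (rule normal.comm_pow_left_Mod[OF N lcc[OF h] g]) (rule comm_in_lc[OF c])
    moreover have "comm (h [^] ?d) g \<in> ?N" by (rule comm_in_lc[OF Suc.IH[OF h] g])
    moreover have "comm (h [^] ?d) g \<in> carrier G" "comm h g [^] ?d \<in> carrier G"
      using lcc[OF h] g by simp_all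
    ultimately have "comm h g [^] ?d \<in> ?N"
      using normal.rcos_eq_self_iff[OF N] by blast
    then show "comm h g \<in> S" unfolding S_def using c by blast
  qed
  then show ?case using Suc.prems unfolding S_def by blast
qed

text \<open>Bounded obliquity bounds the factors of the lower central series. For \<open>x\<close> in one term but not in the
  next, the preimage of the subgroup of \<open>G / lc (i + 2)\<close> consisting of the products \<open>x [^] a \<otimes> comm x g\<close>
  is open and normal, has bounded index over \<open>lc (i + 2)\<close>, and contains the obliquity subgroup of
  \<open>lc (i + 1)\<close>.\<close>
lemma lc_factor_bounded:
  assumes op: "\<And>i. openin T (lc i)"
    and c: "\<And>i. sub_index G (lc i) (Ob G T (lc i)) \<le> enat c"
  shows "sub_index G (lc (Suc i)) (lc (Suc (Suc i))) \<le> enat (c * card (rcosets (lc 1)) ^ 3)"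
proof (cases "lc i \<subseteq> lc (Suc i)")
  case True
  have cpos: "1 \<le> c"
    using c[of i] sub_index_pos[of "lc i" "Ob G T (lc i)"] subgroup.one_closed[OF lc_subgroup]
    by (metis empty_iff enat_ord_simps(1) one_enat_def order_trans)
  have "finite (rcosets (lc 1))" by (rule finite_rcosets_open[OF lc_subgroup op])
  moreover have "rcosets (lc 1) \<noteq> {}"
    using subgroup.subgroup_in_rcosets[OF lc_subgroup is_group] by blast
  ultimately have "card (rcosets (lc 1)) \<ge> 1" by (simp add: Suc_le_eq card_gt_0_iff)
  then have 1: "1 \<le> c * card (rcosets (lc 1)) ^ 3" using cpos by (simp add: one_le_mult_iff)
  have "lc (Suc i) = lc i" using True lc_Suc_subset by blast
  then have "lc (Suc (Suc i)) = lc (Suc i)" using lower_central.simps(3)[of G T] by metis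
  then show ?thesis using sub_index_self[OF lc_subgroup, of "Suc i"] 1 by (simp add: one_enat_def)
next
  case False
  define d where "d = card (rcosets (lc 1))"
  define N where "N = lc (Suc (Suc i))"
  have N: "N \<lhd> G" "subgroup N G" "openin T N" unfolding N_def by (rule lc_normal lc_subgroup op)+
  have lcc: "y \<in> carrier G" if "y \<in> lc j" for y j using subgroup.mem_carrier[OF lc_subgroup that] .
  obtain x where x: "x \<in> lc i" "x \<notin> lc (Suc i)" using False by blast
  have xc: "x \<in> carrier G" by (rule lcc[OF x(1)])
  let ?Q = "G Mod N"
  note hom = normal.group_hom_Mod[OF N(1)]
  interpret Q: group ?Q by (rule normal.factorgroup_is_group[OF N(1)])
  have Qc: "N #> a \<in> carrier ?Q" if "a \<in> carrier G" for a
    using that by (auto simp: carrier_FactGroup)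
  have hm: "N #> (a \<otimes> b) = (N #> a) \<otimes>\<^bsub>?Q\<^esub> (N #> b)" if "a \<in> carrier G" "b \<in> carrier G" for a b
    using group_hom.hom_mult[OF hom that] .
  have hi: "N #> inv a = inv\<^bsub>?Q\<^esub> (N #> a)" if "a \<in> carrier G" for a
    using group_hom.hom_inv[OF hom that] .
  have hc: "N #> comm a b = Q.comm (N #> a) (N #> b)" if "a \<in> carrier G" "b \<in> carrier G" for a b
    using that hm[of "a \<otimes> b \<otimes> inv a" "inv b"] hm[of "a \<otimes> b" "inv a"] hm[of a b] hi by simp
  have central: "Q.comm (N #> x) q \<otimes>\<^bsub>?Q\<^esub> z = z \<otimes>\<^bsub>?Q\<^esub> Q.comm (N #> x) q"
    if qz: "q \<in> carrier ?Q" "z \<in> carrier ?Q" for q z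
  proof -
    obtain g y where g: "g \<in> carrier G" "q = N #> g" and y: "y \<in> carrier G" "z = N #> y"
      using qz by (auto simp: carrier_FactGroup)
    have c: "comm x g \<in> lc (Suc i)" by (rule comm_in_lc[OF x(1) g(1)])
    show ?thesis
      using comm_lc_central[OF c y(1)] hm[OF lcc[OF c] y(1)] hm[OF y(1) lcc[OF c]] hc[OF xc g(1)]
      unfolding g(2) y(2) N_def by simp
  qed
  have comm_hom: "N #> comm x (g \<otimes> h) = (N #> comm x g) \<otimes>\<^bsub>?Q\<^esub> (N #> comm x h)"
    if gh: "g \<in> carrier G" "h \<in> carrier G" for g h
    using Q.comm_mult_right[OF Qc[OF xc] Qc[OF gh(1)] Qc[OF gh(2)] central[OF Qc[OF gh(2)]]]
      hc[OF xc gh(1)] hc[OF xc gh(2)] hc[OF xc m_closed[OF gh]] hm[OF gh] by simp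
  have comm_c: "comm x g \<in> carrier G" if "g \<in> carrier G" for g using xc that by simp
  have N_iff: "N #> a = N \<longleftrightarrow> a \<in> N" if "a \<in> carrier G" for a by (rule normal.rcos_eq_self_iff[OF N(1) that])
  \<comment> \<open>\<open>comm x\<close> is modulo \<open>N\<close> a homomorphism into an abelian group, so it is trivial on \<open>lc 1\<close>; it takes at most
    \<open>d\<close> values, represented by the cosets of \<open>lc 1\<close>.\<close>
  define D where "D = {g \<in> carrier G. comm x g \<in> N}"
  interpret ch: group_hom G ?Q "\<lambda>g. N #> comm x g"
    by unfold_locales (auto simp: hom_def Qc comm_c comm_hom simp del: mult_FactGroup)
  have D_ker: "D = kernel G ?Q (\<lambda>g. N #> comm x g)"
    unfolding D_def kernel_def using N_iff comm_c by auto
  have D: "D \<lhd> G" unfolding D_ker by (rule ch.normal_kernel)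
  have D': "subgroup D G" by (rule normal_imp_subgroup[OF D])
  have ND: "N \<subseteq> D"
  proof
    fix n assume n: "n \<in> N"
    have nc: "n \<in> carrier G" using subgroup.mem_carrier[OF N(2) n] .
    have "(x \<otimes> n \<otimes> inv x) \<otimes> inv n \<in> N"
      by (rule subgroup.m_closed[OF N(2) normal.inv_op_closed2[OF N(1) xc n] subgroup.m_inv_closed[OF N(2) n]])
    then show "n \<in> D" unfolding D_def using nc by simp
  qed
  have "openin T D" by (rule openin_subgroup_superset[OF D' N(3) subgroup.one_closed[OF N(2)] ND])
  then have Dcl: "closedin T D" by (rule closedin_open_subgroup[OF D'])
  have "lc (Suc 0) \<subseteq> D"
  proof (rule lc_Suc_minimal[OF D' Dcl])
    fix h g assume h: "h \<in> lc 0" and g: "g \<in> carrier G"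
    have hcar: "h \<in> carrier G" by (rule lcc[OF h])
    have cx: "N #> comm x a \<in> carrier ?Q" if "a \<in> carrier G" for a by (rule Qc[OF comm_c[OF that]])
    have "N #> comm x (comm h g) = Q.comm (N #> comm x h) (N #> comm x g)"
      using ch.hom_mult[of "h \<otimes> g \<otimes> inv h" "inv g"] ch.hom_mult[of "h \<otimes> g" "inv h"] ch.hom_mult[of h g]
        ch.hom_inv[OF hcar] ch.hom_inv[OF g] hcar g by simp
    also have "(N #> comm x h) \<otimes>\<^bsub>?Q\<^esub> (N #> comm x g) = (N #> comm x g) \<otimes>\<^bsub>?Q\<^esub> (N #> comm x h)"
      using central[OF Qc[OF hcar] cx[OF g]] hc[OF xc hcar] by simp
    also have "\<dots> \<otimes>\<^bsub>?Q\<^esub> inv\<^bsub>?Q\<^esub> (N #> comm x h) \<otimes>\<^bsub>?Q\<^esub> inv\<^bsub>?Q\<^esub> (N #> comm x g) = \<one>\<^bsub>?Q\<^esub>"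
      using cx[OF hcar] cx[OF g] by (simp add: Q.m_assoc del: mult_FactGroup one_FactGroup)
    finally have "N #> comm x (comm h g) = N" by (simp only: one_FactGroup)
    moreover have "comm h g \<in> carrier G" using hcar g by simp
    ultimately have "comm x (comm h g) \<in> N" using N_iff[OF comm_c] by blast
    then show "comm h g \<in> D" unfolding D_def using hcar g by simp
  qed
  then have lcD: "lc 1 \<subseteq> D" by simp
  define rep where "rep R = (SOME r. r \<in> R)" for R :: "'a set"
  define Rs where "Rs = (\<lambda>R. N #> rep R) ` (rcosets (lc 1))"
  have finR: "finite (rcosets (lc 1))" by (rule finite_rcosets_open[OF lc_subgroup op])
  have rep: "rep (lc 1 #> g) \<in> lc 1 #> g" if "g \<in> carrier G" for g
    unfolding rep_def by (rule someI[of "\<lambda>r. r \<in> lc 1 #> g", OF rcos_self[OF that lc_subgroup]])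
  have repc: "rep (lc 1 #> g) \<in> carrier G" if "g \<in> carrier G" for g
    using rep[OF that] r_coset_subset_G[OF subgroup.subset[OF lc_subgroup] that, of 1] by blast
  have Rs1: "finite Rs" "card Rs \<le> d"
    unfolding Rs_def d_def using finR by (auto intro: card_image_le)
  have Rs2: "Rs \<subseteq> carrier ?Q"
  proof
    fix q assume "q \<in> Rs"
    then obtain g where "g \<in> carrier G" "q = N #> rep (lc 1 #> g)" unfolding Rs_def RCOSETS_def by blast
    then show "q \<in> carrier ?Q" using Qc[OF repc] by blast
  qed
  have Rs3: "\<exists>r\<in>Rs. Q.comm (N #> x) q = Q.comm (N #> x) r" if q: "q \<in> carrier ?Q" for q
  proof -
    obtain g where g: "g \<in> carrier G" "q = N #> g" using q by (auto simp: carrier_FactGroup)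
    let ?r = "rep (lc 1 #> g)"
    obtain a where a: "a \<in> lc 1" "?r = a \<otimes> g" using rep[OF g(1)] unfolding r_coset_def by blast
    have "N #> comm x a = N" using a(1) lcD N_iff[OF comm_c[OF lcc[OF a(1)]]] unfolding D_def by blast
    then have "N #> comm x ?r = \<one>\<^bsub>?Q\<^esub> \<otimes>\<^bsub>?Q\<^esub> (N #> comm x g)"
      unfolding a(2) comm_hom[OF lcc[OF a(1)] g(1)] by simp
    also have "\<dots> = N #> comm x g" by (rule Q.l_one[OF Qc[OF comm_c[OF g(1)]]])
    finally have "Q.comm (N #> x) q = Q.comm (N #> x) (N #> ?r)"
      using hc[OF xc g(1)] hc[OF xc repc[OF g(1)]] g(2) by simp
    moreover have "N #> ?r \<in> Rs" unfolding Rs_def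
      using rcosetsI[OF subgroup.subset[OF lc_subgroup] g(1), of 1] by blast
    ultimately show ?thesis by blast
  qed
  have dpos: "d * d > 0"
    using finR subgroup.subgroup_in_rcosets[OF lc_subgroup is_group, of 1] unfolding d_def
    by (auto simp: card_gt_0_iff)
  \<comment> \<open>The exponent \<open>d\<close> of the factors is used twice, to pass from \<open>lc i\<close> down to \<open>lc (i + 2)\<close>.\<close>
  have "x [^] (d * d) \<in> N"
    using lc_factor_exponent[OF op lc_factor_exponent[OF op x(1)]] xc
    unfolding d_def N_def by (simp add: nat_pow_pow)
  then have xE: "(N #> x) [^]\<^bsub>?Q\<^esub> (d * d) = \<one>\<^bsub>?Q\<^esub>"
    unfolding normal.FactGroup_pow[OF N(1) xc] using N_iff xc by simp
  define K' where "K' = {(N #> x) [^]\<^bsub>?Q\<^esub> (a::nat) \<otimes>\<^bsub>?Q\<^esub> Q.comm (N #> x) q | a q. q \<in> carrier ?Q}"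
  note K' = Q.cyclic_times_comm[OF Qc[OF xc] dpos xE central Rs1(1) Rs2 Rs3, folded K'_def]
  define K where "K = {g \<in> carrier G. N #> g \<in> K'}"
  have K: "K \<lhd> G" unfolding K_def by (rule normal.normal_vimage_Mod[OF N(1) K'(1)])
  have K_sub: "subgroup K G" by (rule normal_imp_subgroup[OF K])
  have NK: "N \<subseteq> K"
  proof
    fix n assume n: "n \<in> N"
    have nc: "n \<in> carrier G" using subgroup.mem_carrier[OF N(2) n] .
    have "N #> n = \<one>\<^bsub>?Q\<^esub>" using N_iff[OF nc] n by simp
    also have "\<dots> \<in> K'" by (rule subgroup.one_closed[OF normal_imp_subgroup[OF K'(1)]])
    finally show "n \<in> K" unfolding K_def using nc by blast
  qed
  have openK: "open_normal G T K"
    by (rule open_normal_superset[OF _ K NK]) (simp add: open_normal_def N)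
  have "x \<in> K" unfolding K_def using xc K'(2) by blast
  then have ObK: "Ob G T (lc (Suc i)) \<subseteq> K" using Ob_subset_open_normal[OF openK] x(2) by blast
  have "(\<lambda>a. N #> a) ` K \<subseteq> K'" unfolding K_def by blast
  then have "finite ((\<lambda>a. N #> a) ` K)" "card ((\<lambda>a. N #> a) ` K) \<le> card K'"
    using K'(3) finite_subset card_mono by blast+
  moreover have "card K' \<le> d * d * d" using K'(4) Rs1(2) mult_le_mono2 order_trans by blast
  ultimately have KN: "sub_index G K N \<le> enat (d ^ 3)"
    unfolding sub_index_eq by (simp add: power3_eq_cube)
  let ?M = "K \<inter> lc (Suc i)"
  have M: "subgroup ?M G" by (rule subgroups_Inter_pair[OF K_sub lc_subgroup])
  have Ob_sub: "subgroup (Ob G T (lc (Suc i))) G"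
    by (rule normal_imp_subgroup[OF Ob_closed_normal(1)[OF lc_normal lc_closed]])
  have "sub_index G (lc (Suc i)) N = sub_index G (lc (Suc i)) ?M * sub_index G ?M N"
    by (rule sub_index_mult[OF lc_subgroup M N(2)]) (use NK lc_Suc_subset in \<open>auto simp: N_def\<close>)
  also have "\<dots> \<le> enat c * enat (d ^ 3)"
  proof (rule mult_mono)
    have "sub_index G (lc (Suc i)) ?M \<le> sub_index G (lc (Suc i)) (Ob G T (lc (Suc i)))"
      by (rule sub_index_anti_mono[OF lc_subgroup M Ob_sub]) (use ObK Ob_subset in auto)
    then show "sub_index G (lc (Suc i)) ?M \<le> enat c" using c order_trans by blast
    have "sub_index G ?M N \<le> sub_index G K N" by (rule sub_index_mono) blast
    then show "sub_index G ?M N \<le> enat (d ^ 3)" using KN order_trans by blast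
  qed auto
  finally show ?thesis unfolding N_def d_def by simp
qed

end

section \<open>Obliquity and the growth of \<open>ob\<close>\<close>

context profinite_group
begin

lemma Ob_normal_core_upto:
  assumes "n > 0"
  shows "Ob G T (normal_core_upto G T n) \<lhd> G" "closedin T (Ob G T (normal_core_upto G T n))"
  using Ob_closed_normal[OF normal_core_upto_closed_normal[OF assms]] by blast+

lemma group_index_anti_mono:
  assumes "subgroup B G" "subgroup C G" "C \<subseteq> B"
  shows "group_index G B \<le> group_index G C"
  unfolding group_index_def
  by (rule sub_index_anti_mono[OF subgroup_self assms(1,2) subgroup.subset[OF assms(1)] assms(3)])

end

context pro_p_group
begin

lemma lc_subset_Ob:
  assumes p: "prime p" and op: "\<And>i. openin T (lc i)"
    and c: "sub_index G (lc i) (Ob G T (lc i)) \<le> enat c"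
  shows "open_normal G T (Ob G T (lc i))" "lc (i + c) \<subseteq> Ob G T (lc i)"
proof -
  note Ob = Ob_closed_normal[OF lc_normal lc_closed, of i]
  note ObS = normal_imp_subgroup[OF Ob(1)]
  have on: "open_normal G T (lc i)" unfolding open_normal_def using lc_normal op by blast
  have "group_index G (Ob G T (lc i)) = group_index G (lc i) * sub_index G (lc i) (Ob G T (lc i))"
    unfolding group_index_def
    by (rule sub_index_mult[OF subgroup_self lc_subgroup ObS subgroup.subset[OF lc_subgroup] Ob_subset])
  also have "\<dots> < \<infinity>"
    unfolding group_index_open_normal[OF on] using c
    by (cases "sub_index G (lc i) (Ob G T (lc i))") auto
  finally show on: "open_normal G T (Ob G T (lc i))"
    by (rule closed_normal_finite_index[OF Ob])
  have "enat c \<le> enat (Suc c)" by simp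
  then show "lc (i + c) \<subseteq> Ob G T (lc i)"
    using lc_subset_of_index[OF p lc_subgroup lc_normal order_refl on Ob_subset] c order_trans by blast
qed

text \<open>If all indices \<open>group_index G (lc i)\<close> are at most \<open>n\<close>, the series becomes stationary, and its last
  term lies in every open normal subgroup.\<close>
lemma lc_bounded_index_minimal:
  assumes p: "prime p" and op: "\<And>i. openin T (lc i)" and b: "\<And>i. group_index G (lc i) \<le> enat n"
  shows "\<exists>J. \<forall>N. open_normal G T N \<longrightarrow> lc J \<subseteq> N"
proof -
  define f where "f i = card (rcosets (lc i))" for i
  have on: "open_normal G T (lc i)" for i unfolding open_normal_def using lc_normal op by blast
  have f: "group_index G (lc i) = enat (f i)" for i
    unfolding f_def by (rule group_index_open_normal[OF on])
  have "\<exists>J. True \<and> (\<forall>i. True \<longrightarrow> f i \<le> f J)"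
    by (rule ex_has_greatest_nat[of "\<lambda>_. True" 0 f "Suc n"]) (use b f in \<open>simp_all add: less_Suc_eq_le\<close>)
  then obtain J where J: "\<And>i. f i \<le> f J" by blast
  have "lc J \<subseteq> N" if N: "open_normal G T N" for N
  proof -
    obtain j where j: "lc j \<subseteq> N" using lc_eventually_subset[OF p N] by blast
    let ?m = "max j J"
    have mJ: "lc ?m \<subseteq> lc J" by (rule lc_antimono) simp
    have "group_index G (lc ?m) = group_index G (lc J) * sub_index G (lc J) (lc ?m)"
      unfolding group_index_def
      by (rule sub_index_mult[OF subgroup_self lc_subgroup lc_subgroup subgroup.subset[OF lc_subgroup] mJ])
    then have eq: "enat (f ?m) = enat (f J) * sub_index G (lc J) (lc ?m)" unfolding f .
    have "f J \<noteq> 0"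
      using sub_index_pos[OF carrier_not_empty, of "lc J"] f[of J] unfolding group_index_def
      by (simp add: one_enat_def)
    then have "sub_index G (lc J) (lc ?m) \<le> 1"
      using eq J[of ?m] by (cases "sub_index G (lc J) (lc ?m)") (auto simp: one_enat_def)
    then have "lc J = lc ?m" by (rule sub_index_eq_1_imp[OF lc_subgroup lc_subgroup mJ])
    then show ?thesis using j lc_antimono[of j ?m] by auto
  qed
  then show ?thesis by blast
qed

text \<open>Let \<open>lc i\<close> be the last term of index at most \<open>n\<close>. Then \<open>normal_core_upto G T n\<close> contains
  \<open>Ob (lc (i + 1))\<close> and therefore a term \<open>lc j\<close> whose distance \<open>j - i\<close> from it does not depend on \<open>n\<close>.\<close>
lemma ob_linear_of_bounded_obliquity:
  assumes p: "prime p" and op: "\<And>i. openin T (lc i)"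
    and c: "\<And>i. sub_index G (lc i) (Ob G T (lc i)) \<le> enat c"
  shows "\<exists>K. \<forall>n>0. ob G T n \<le> enat (K * n)"
proof -
  define d where "d = card (rcosets (lc 1))"
  define w where "w = d + c * d ^ 3"
  have on: "open_normal G T (lc i)" for i unfolding open_normal_def using lc_normal op by blast
  have idx1: "sub_index G (lc i) (lc (Suc i)) \<le> enat w" for i
  proof (cases i)
    case 0
    then show ?thesis
      using group_index_open_normal[OF on[of 1]] unfolding w_def d_def group_index_def by simp
  next
    case (Suc j)
    have "enat (c * d ^ 3) \<le> enat w" unfolding w_def by simp
    then show ?thesis using lc_factor_bounded[OF op c, of j] unfolding Suc d_def by (rule order_trans[rotated])
  qed
  have idx: "sub_index G (lc i) (lc (i + m)) \<le> enat (w ^ m)" for i m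
  proof (induction m)
    case 0 then show ?case using sub_index_self[OF lc_subgroup] by (simp add: one_enat_def)
  next
    case (Suc m)
    have "sub_index G (lc i) (lc (i + Suc m)) = sub_index G (lc i) (lc (i + m)) * sub_index G (lc (i + m)) (lc (i + Suc m))"
      by (rule sub_index_mult[OF lc_subgroup lc_subgroup lc_subgroup]) (rule lc_antimono, simp)+
    also have "\<dots> \<le> enat (w ^ m) * enat w"
      by (rule mult_mono) (use Suc idx1[of "i + m"] in auto)
    finally show ?case by (simp add: mult.commute)
  qed
  have "ob G T n \<le> enat ((w ^ Suc c * c + 1) * n)" if n: "n > 0" for n
  proof -
    let ?I = "normal_core_upto G T n"
    note ObI = normal_imp_subgroup[OF Ob_normal_core_upto(1)[OF n]]
    show ?thesis
    proof (cases "\<forall>i. group_index G (lc i) \<le> enat n")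
      case True
      then obtain J where J: "\<And>N. open_normal G T N \<Longrightarrow> lc J \<subseteq> N"
        using lc_bounded_index_minimal[OF p op] by blast
      have "lc J \<subseteq> ?I" unfolding normal_core_upto_def using J by blast
      then have "lc J \<subseteq> Ob G T ?I" unfolding Ob_def using J by blast
      then have "ob G T n \<le> group_index G (lc J)"
        unfolding ob_def by (rule group_index_anti_mono[OF ObI lc_subgroup])
      also have "\<dots> \<le> enat n" using True by blast
      finally show ?thesis using order_trans[of "ob G T n" "enat n" "enat ((w ^ Suc c * c + 1) * n)"] by simp
    next
      case False
      let ?P = "\<lambda>i. \<not> group_index G (lc i) \<le> enat n"
      define l where "l = (LEAST i. ?P i)"
      have l: "?P l" unfolding l_def 
        by (rule LeastI_ex) (use False in blast)
      have "group_index G (lc 0) = 1"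
        unfolding group_index_def using sub_index_self[OF subgroup_self] by simp
      then have "\<not> ?P 0" using n by (simp add: one_enat_def)
      then obtain i where i: "l = Suc i" using l by (cases l) auto
      have idx_i: "group_index G (lc i) \<le> enat n"
        using not_less_Least[of i ?P] unfolding l_def[symmetric] i by simp
      have Ob1: "Ob G T (lc (Suc i)) \<subseteq> ?I"
        unfolding normal_core_upto_def
      proof (rule Inter_greatest)
        fix N assume "N \<in> {N. open_normal G T N \<and> group_index G N \<le> enat n}"
        then have N: "open_normal G T N" "group_index G N \<le> enat n" by blast+
        have "\<not> N \<subseteq> lc (Suc i)"
        proof
          assume "N \<subseteq> lc (Suc i)"
          then have "group_index G (lc (Suc i)) \<le> group_index G N"
            by (rule group_index_anti_mono[OF lc_subgroup open_normalD(2)[OF N(1)]])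
          then show False using N(2) l unfolding i by (meson order_trans)
        qed
        then show "Ob G T (lc (Suc i)) \<subseteq> N" by (rule Ob_subset_open_normal[OF N(1)])
      qed
      let ?j = "i + Suc c"
      have "lc ?j \<subseteq> ?I" using lc_subset_Ob(2)[OF p op c, of "Suc i"] Ob1 by simp
      then have "Ob G T (lc ?j) \<subseteq> Ob G T ?I" by (rule Ob_mono)
      note Obj = normal_imp_subgroup[OF Ob_closed_normal(1)[OF lc_normal[of ?j] lc_closed[of ?j]]]
      have "ob G T n \<le> group_index G (Ob G T (lc ?j))"
        unfolding ob_def by (rule group_index_anti_mono[OF ObI Obj]) fact
      also have "\<dots> = sub_index G (carrier G) (lc i) * sub_index G (lc i) (Ob G T (lc ?j))"
        unfolding group_index_def
        by (rule sub_index_mult[OF subgroup_self lc_subgroup Obj subgroup.subset[OF lc_subgroup]])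
           (use Ob_subset[of "lc ?j"] lc_antimono[of i ?j] in auto)
      also have "sub_index G (lc i) (Ob G T (lc ?j)) = sub_index G (lc i) (lc ?j) * sub_index G (lc ?j) (Ob G T (lc ?j))"
        by (rule sub_index_mult[OF lc_subgroup lc_subgroup Obj lc_antimono Ob_subset]) simp
      also have "sub_index G (carrier G) (lc i) * \<dots> \<le> enat n * (enat (w ^ Suc c) * enat c)"
        by (intro mult_mono) (use idx_i idx[of i "Suc c"] c[of ?j] in \<open>auto simp: group_index_def\<close>)
      also have "\<dots> \<le> enat ((w ^ Suc c * c + 1) * n)" by simp
      finally show ?thesis .
    qed
  qed
  then show ?thesis by blast
qed

lemma finite_obliquity_iff:
  assumes p: "prime p"
  shows "finite_obliquity p G T \<longleftrightarrow>
    (\<forall>i. openin T (lc i)) \<and> (\<exists>c. \<forall>i. sub_index G (lc i) (Ob G T (lc i)) \<le> enat c)"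
proof -
  have p1: "real p > 1" using prime_gt_1_nat[OF p] by simp
  have op: "(\<forall>i\<ge>1. openin T (lower_central G T i)) \<longleftrightarrow> (\<forall>i. openin T (lc i))"
    by (metis Suc_le_D Suc_le_mono One_nat_def zero_le)
  have "obliquity p G T < \<infinity> \<longleftrightarrow> (\<exists>c. \<forall>i. sub_index G (lc i) (Ob G T (lc i)) \<le> enat c)" (is "_ = ?R")
  proof
    assume fin: "obliquity p G T < \<infinity>"
    obtain B where B: "obliquity p G T \<le> ereal B"
      using fin by (cases "obliquity p G T") auto
    define c where "c = nat \<lceil>real p powr B\<rceil> + 1"
    have "sub_index G (lc i) (Ob G T (lc i)) \<le> enat c" for i
    proof (cases i)
      case 0
      have "Ob G T (carrier G) = carrier G"
        unfolding Ob_def using open_normalD(2) subgroup.subset by blast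
      then show ?thesis using sub_index_self[OF subgroup_self] 0 by (simp add: one_enat_def c_def)
    next
      case (Suc j)
      have "obliquity_at p G T i \<le> ereal B"
        using B SUP_le_iff[of "obliquity_at p G T" "{1..}" "ereal B"] Suc unfolding obliquity_def by auto
      then have el: "elog p (sub_index G (lc i) (Ob G T (lc i))) \<le> ereal B"
        unfolding obliquity_at_def Let_def by simp
      show ?thesis
      proof (cases "sub_index G (lc i) (Ob G T (lc i))")
        case (enat m)
        have "m \<ge> 1" using sub_index_pos[of "lc i" "Ob G T (lc i)"] subgroup.one_closed[OF lc_subgroup] enat
          by (metis empty_iff enat_ord_simps(1) one_enat_def)
        then have m0: "0 < real m" by simp
        have "log (real p) (real m) \<le> B" using el unfolding enat elog_def by simp
        then have "real m \<le> real p powr B" using log_le_iff[OF p1 m0] by simp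
        then have "m \<le> c" unfolding c_def by linarith
        then show ?thesis using enat by simp
      next
        case infinity
        then show ?thesis using el unfolding infinity elog_def by simp
      qed
    qed
    then show ?R by blast
  next
    assume ?R
    then obtain c where c: "\<And>i. sub_index G (lc i) (Ob G T (lc i)) \<le> enat c" by blast
    have "obliquity_at p G T i \<le> ereal (log (real p) (real c))" for i
    proof -
      obtain m where m: "sub_index G (lc i) (Ob G T (lc i)) = enat m" "m \<le> c"
        using c[of i] by (cases "sub_index G (lc i) (Ob G T (lc i))") auto
      have "m \<ge> 1" using sub_index_pos[of "lc i" "Ob G T (lc i)"] subgroup.one_closed[OF lc_subgroup] m
          by (metis empty_iff enat_ord_simps(1) one_enat_def)
      then have "log (real p) (real m) \<le> log (real p) (real c)" using m(2) p1 by simp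
      then show ?thesis unfolding obliquity_at_def Let_def using m(1) by (simp add: elog_def)
    qed
    then have "obliquity p G T \<le> ereal (log (real p) (real c))" unfolding obliquity_def by (intro SUP_least)
    then show "obliquity p G T < \<infinity>" using order_le_less_trans by fastforce
  qed
  then show ?thesis unfolding finite_obliquity_def op by blast
qed

text \<open>Conversely, a linear bound on \<open>ob\<close> bounds \<open>|H : Ob H|\<close> over all open normal subgroups \<open>H\<close>.\<close>
lemma Ob_index_bounded_of_ob_linear:
  fixes k :: real
  assumes k: "\<And>n. n > 0 \<Longrightarrow> ereal_of_enat (ob G T n) \<le> ereal (k * real n)" and H: "open_normal G T H"
  shows "sub_index G H (Ob G T H) \<le> enat (nat \<lfloor>k\<rfloor>)"
proof -
  note H' = open_normalD[OF H]
  define n where "n = card (rcosets H)"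
  have gi: "group_index G H = enat n" unfolding n_def by (rule group_index_open_normal[OF H])
  then have n: "n > 0"
    using sub_index_pos[OF carrier_not_empty, of H] unfolding group_index_def by (simp add: one_enat_def)
  note Ob = normal_imp_subgroup[OF Ob_closed_normal(1)[OF H'(1,4)]]
  have "normal_core_upto G T n \<subseteq> H" by (rule normal_core_upto_subset[OF H]) (simp add: gi)
  then have "group_index G (Ob G T H) \<le> ob G T n"
    unfolding ob_def
    by (intro group_index_anti_mono[OF Ob normal_imp_subgroup[OF Ob_normal_core_upto(1)[OF n]]] Ob_mono)
  moreover have "group_index G (Ob G T H) = group_index G H * sub_index G H (Ob G T H)"
    unfolding group_index_def
    by (rule sub_index_mult[OF subgroup_self H'(2) Ob subgroup.subset[OF H'(2)] Ob_subset])
  ultimately have "enat n * sub_index G H (Ob G T H) \<le> ob G T n" unfolding gi by simp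
  then have "ereal_of_enat (enat n * sub_index G H (Ob G T H)) \<le> ereal (k * real n)"
    using k[OF n] order_trans by (metis ereal_of_enat_le_iff)
  then show ?thesis
  proof (cases "sub_index G H (Ob G T H)")
    case (enat m)
    assume "ereal_of_enat (enat n * sub_index G H (Ob G T H)) \<le> ereal (k * real n)"
    then have "real n * real m \<le> k * real n" unfolding enat by simp
    then have "real m \<le> k" using n by (simp add: mult.commute)
    then have "m \<le> nat \<lfloor>k\<rfloor>" by (simp add: le_nat_floor)
    then show ?thesis using enat by simp
  next
    case infinity
    assume "ereal_of_enat (enat n * sub_index G H (Ob G T H)) \<le> ereal (k * real n)"
    then show ?thesis unfolding infinity using n by (simp add: zero_enat_def)
  qed
qed

end

section \<open>Just infinite groups\<close>

context profinite_group
begin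

lemma closedin_finite: "\<lbrakk>finite S; S \<subseteq> carrier G\<rbrakk> \<Longrightarrow> closedin T S"
  using closedin_Hausdorff_finite[OF Hausdorff] topspace_eq_carrier by simp

lemma open_normal_avoiding:
  assumes "closedin T S" "\<one> \<notin> S"
  shows "\<exists>N. open_normal G T N \<and> N \<inter> S = {}"
proof -
  have "openin T (carrier G - S)" using assms(1) by (simp add: closedin_def topspace_eq_carrier)
  then obtain N where "open_normal G T N" "N \<subseteq> carrier G - S"
    using open_normal_base[of "carrier G - S"] assms(2) by blast
  then show ?thesis by blast
qed

lemma eq_one_of_in_open_normals:
  assumes "x \<in> carrier G" "\<And>N. open_normal G T N \<Longrightarrow> x \<in> N"
  shows "x = \<one>"
proof (rule ccontr)
  assume "x \<noteq> \<one>"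
  then show False using open_normal_avoiding[of "{x}"] closedin_finite[of "{x}"] assms by auto
qed

text \<open>Finite obliquity indices make the group just infinite. If \<open>N\<close> is open normal and does not contain
  the closed normal subgroup \<open>F\<close>, then neither do the products \<open>M F\<close> with \<open>M\<close> open normal lie in \<open>N\<close>, and
  these intersect in \<open>F\<close>; hence \<open>F\<close> contains the open subgroup \<open>Ob N\<close>.\<close>
lemma just_infinite_of_Ob:
  assumes Ob: "\<And>H. open_normal G T H \<Longrightarrow> sub_index G H (Ob G T H) < \<infinity>"
    and F: "F \<lhd> G" "closedin T F" "F \<noteq> {\<one>}"
  shows "openin T F"
proof -
  have F': "subgroup F G" by (rule normal_imp_subgroup[OF F(1)])
  obtain f where f: "f \<in> F" "f \<noteq> \<one>" using F(3) subgroup.one_closed[OF F'] by blast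
  have fc: "f \<in> carrier G" using subgroup.mem_carrier[OF F' f(1)] .
  obtain N where N: "open_normal G T N" "f \<notin> N"
    using open_normal_avoiding[OF closedin_finite[of "{f}"]] f fc by auto
  note N' = open_normalD[OF N(1)]
  have "Ob G T N \<subseteq> F"
  proof (rule subsetI, rule ccontr)
    fix y assume y: "y \<in> Ob G T N" and yF: "y \<notin> F"
    have yc: "y \<in> carrier G" using y Ob_subset[of N] subgroup.mem_carrier[OF N'(2)] by blast
    have "openin T (carrier G - F)" using F(2) by (simp add: closedin_def topspace_eq_carrier)
    then obtain M where M: "open_normal G T M" "M #> y \<subseteq> carrier G - F"
      using open_normal_base_translate[of "carrier G - F" y] yF yc by blast
    note M' = open_normalD[OF M(1)]
    define K where "K = {x \<in> carrier G. M #> x \<in> (\<lambda>a. M #> a) ` F}"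
    have "(\<lambda>a. M #> a) ` F \<lhd> G Mod M"
      by (rule normal.surj_hom_normal_subgroup[OF F(1) normal.group_hom_Mod[OF M'(1)]])
         (simp add: carrier_FactGroup)
    then have K: "K \<lhd> G" unfolding K_def by (rule normal.normal_vimage_Mod[OF M'(1)])
    have "M \<subseteq> K"
    proof
      fix m assume m: "m \<in> M"
      have mc: "m \<in> carrier G" using subgroup.mem_carrier[OF M'(2) m] .
      have "M #> m = M #> \<one>"
        using subgroup.rcos_const[OF M'(2) is_group m] subgroup.rcos_const[OF M'(2) is_group subgroup.one_closed[OF M'(2)]] by simp
      then show "m \<in> K" unfolding K_def using mc subgroup.one_closed[OF F'] by blast
    qed
    then have "open_normal G T K" by (rule open_normal_superset[OF M(1) K])
    moreover have "f \<in> K" unfolding K_def using f fc by blast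
    ultimately have "Ob G T N \<subseteq> K" using Ob_subset_open_normal N(2) by blast
    then have "y \<in> K" using y by blast
    then obtain f' where f': "f' \<in> F" "M #> y = M #> f'" unfolding K_def by blast
    have "f' \<in> M #> f'" by (rule rcos_self[OF subgroup.mem_carrier[OF F' f'(1)] M'(2)])
    then show False using M(2) f' by blast
  qed
  moreover have "group_index G (Ob G T N) < \<infinity>"
  proof -
    have "subgroup (Ob G T N) G" by (rule normal_imp_subgroup[OF Ob_closed_normal(1)[OF N'(1,4)]])
    then have "group_index G (Ob G T N) = group_index G N * sub_index G N (Ob G T N)"
      unfolding group_index_def
      by (rule sub_index_mult[OF subgroup_self N'(2) _ subgroup.subset[OF N'(2)] Ob_subset])
    then show ?thesis unfolding group_index_open_normal[OF N(1)]
      using Ob[OF N(1)] by (cases "sub_index G N (Ob G T N)") auto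
  qed
  ultimately have "group_index G F < \<infinity>"
    using group_index_anti_mono[OF F' normal_imp_subgroup[OF Ob_closed_normal(1)[OF N'(1,4)]]]
    by (meson order_le_less_trans)
  then show ?thesis using closed_normal_finite_index[OF F(1,2)] unfolding open_normal_def by blast
qed

text \<open>A nontrivial central element of finite order would generate a finite normal subgroup. In a just infinite
  group it would be open, and then so would be the trivial subgroup.\<close>
lemma central_torsion_trivial:
  fixes m :: nat
  assumes ji: "\<And>F. \<lbrakk>F \<lhd> G; closedin T F; F \<noteq> {\<one>}\<rbrakk> \<Longrightarrow> openin T F"
    and nd: "\<not> openin T {\<one>}"
    and x: "x \<in> carrier G" "\<And>g. g \<in> carrier G \<Longrightarrow> comm x g = \<one>" and m: "m > 0" "x [^] m = \<one>"
  shows "x = \<one>"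
proof (rule ccontr)
  assume ne: "x \<noteq> \<one>"
  define K where "K = {x [^] (a::nat) \<otimes> comm x g | a g. g \<in> carrier G}"
  have "comm x g \<otimes> z = z \<otimes> comm x g" if "g \<in> carrier G" "z \<in> carrier G" for g z
    using x(2)[OF that(1)] that by simp
  moreover have "\<exists>r\<in>{\<one>}. comm x g = comm x r" if "g \<in> carrier G" for g
    using x(2)[OF that] x(2)[OF one_closed] by (intro bexI[of _ "\<one>"]) auto
  ultimately have K: "K \<lhd> G" "x \<in> K" "finite K"
    using cyclic_times_comm[OF x(1) m, of "{\<one>}"] unfolding K_def by auto
  have Kc: "K \<subseteq> carrier G" by (rule subgroup.subset[OF normal_imp_subgroup[OF K(1)]])
  have "openin T K" by (rule ji[OF K(1) closedin_finite[OF K(3) Kc]]) (use K(2) ne in blast)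
  moreover have "closedin T (K - {\<one>})" by (rule closedin_finite) (use K(3) Kc in auto)
  ultimately have "openin T (K - (K - {\<one>}))" by (rule openin_diff)
  moreover have "K - (K - {\<one>}) = {\<one>}" using subgroup.one_closed[OF normal_imp_subgroup[OF K(1)]] by blast
  ultimately show False using nd by simp
qed

text \<open>A just infinite group whose lower central series has a term that is not open is abelian. The first such term
  is trivial, so the preceding term \<open>lc i\<close> is central and open. If \<open>i > 0\<close>, it contains a nontrivial commutator
  \<open>comm h g\<close>, which is killed by \<open>m = |G : lc i|\<close> because \<open>h [^] m\<close> is central.\<close>
lemma just_infinite_lc_cases:
  assumes ji: "\<And>F. \<lbrakk>F \<lhd> G; closedin T F; F \<noteq> {\<one>}\<rbrakk> \<Longrightarrow> openin T F"
    and no: "\<not> (\<forall>i. openin T (lc i))"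
  shows "\<not> openin T {\<one>}" "\<And>x y. \<lbrakk>x \<in> carrier G; y \<in> carrier G\<rbrakk> \<Longrightarrow> x \<otimes> y = y \<otimes> x"
proof -
  define l where "l = (LEAST i. \<not> openin T (lc i))"
  have l: "\<not> openin T (lc l)" unfolding l_def by (rule LeastI_ex) (use no in blast)
  have "openin T (lc 0)" using openin_topspace[of T] by (simp add: topspace_eq_carrier)
  then obtain i where i: "l = Suc i" using l by (cases l) auto
  have opi: "openin T (lc i)" using not_less_Least[of i "\<lambda>i. \<not> openin T (lc i)"] unfolding l_def[symmetric] i by simp
  have one: "lc (Suc i) = {\<one>}" using ji[OF lc_normal lc_closed, of "Suc i"] l unfolding i by blast
  show nd: "\<not> openin T {\<one>}" using l unfolding i one .
  have "i = 0"
  proof (rule ccontr)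
    assume "i \<noteq> 0"
    then obtain j where j: "i = Suc j" by (cases i) auto
    have "\<exists>h g. h \<in> lc j \<and> g \<in> carrier G \<and> comm h g \<noteq> \<one>"
    proof (rule ccontr)
      assume "\<not> ?thesis"
      then have "comm h g \<in> {\<one>}" if "h \<in> lc j" "g \<in> carrier G" for h g using that by blast
      then have "lc i \<subseteq> {\<one>}" unfolding j
        by (rule lc_Suc_minimal[OF triv_subgroup closedin_finite, rotated 2]) auto
      then have "lc i = {\<one>}" using subgroup.one_closed[OF lc_subgroup, of i] by blast
      then show False using opi nd by simp
    qed
    then obtain h g where h: "h \<in> lc j" and g: "g \<in> carrier G" and ne: "comm h g \<noteq> \<one>" by blast
    have hc: "h \<in> carrier G" by (rule subgroup.mem_carrier[OF lc_subgroup h])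
    have y: "comm h g \<in> lc i" unfolding j by (rule comm_in_lc[OF h g])
    have yc: "comm h g \<in> carrier G" by (rule subgroup.mem_carrier[OF lc_subgroup y])
    have central: "comm (comm h g) z = \<one>" if "z \<in> carrier G" for z
      using comm_in_lc[OF y that] one by blast
    have central': "comm h g \<otimes> z = z \<otimes> comm h g" if z: "z \<in> carrier G" for z
    proof -
      have "comm (comm h g) z \<otimes> z \<otimes> comm h g = comm h g \<otimes> z" using z yc hc g by (simp add: m_assoc)
      then show ?thesis unfolding central[OF z] using z yc by simp
    qed
    define m where "m = card (rcosets (lc i))"
    have fin: "finite (rcosets (lc i))" by (rule finite_rcosets_open[OF lc_subgroup opi])
    have m: "m > 0" unfolding m_def
      using fin subgroup.subgroup_in_rcosets[OF lc_subgroup is_group, of i] by (auto simp: card_gt_0_iff)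
    have "h [^] m \<in> lc i" unfolding m_def by (rule normal.pow_index_mem[OF lc_normal fin hc])
    then have "comm (h [^] m) g = \<one>" using comm_in_lc[OF _ g, of "h [^] m" i] one by blast
    then have "comm h g [^] m = \<one>" using comm_pow_left[OF hc g central'] by simp
    with ji nd yc central m have "comm h g = \<one>" by (rule central_torsion_trivial)
    then show False using ne by simp
  qed
  then have c1: "comm x y = \<one>" if "x \<in> carrier G" "y \<in> carrier G" for x y
    using comm_in_lc[of x 0 y] that one by auto
  show "x \<otimes> y = y \<otimes> x" if xy: "x \<in> carrier G" "y \<in> carrier G" for x y
  proof -
    have "comm x y \<otimes> y \<otimes> x = x \<otimes> y" using xy by (simp add: m_assoc)
    then show ?thesis unfolding c1[OF xy] using xy by simp
  qed
qed

end

section \<open>Powers in torsion-free abelian groups\<close>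

text \<open>The image of the \<open>q\<close>-th power map.\<close>
definition (in group) powers :: "nat \<Rightarrow> 'a set" where
  "powers q = (\<lambda>x. x [^] q) ` carrier G"

context comm_group
begin

lemma powers_subgroup: "subgroup (powers q) G"
proof (rule subgroupI)
  show "powers q \<subseteq> carrier G" unfolding powers_def by auto
  show "powers q \<noteq> {}" unfolding powers_def using carrier_not_empty by blast
next
  fix a assume "a \<in> powers q"
  then obtain x where x: "x \<in> carrier G" "a = x [^] q" unfolding powers_def by blast
  then have "inv a = inv x [^] q" by (simp add: nat_pow_inv)
  then show "inv a \<in> powers q" unfolding powers_def using x by blast
next
  fix a b assume "a \<in> powers q" "b \<in> powers q"
  then obtain x y where x: "x \<in> carrier G" "a = x [^] q" "y \<in> carrier G" "b = y [^] q"
    unfolding powers_def by blast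
  then have "a \<otimes> b = (x \<otimes> y) [^] q" by (simp add: nat_pow_distrib)
  then show "a \<otimes> b \<in> powers q" unfolding powers_def using x by blast
qed

lemma powers_pow: "x \<in> powers q \<Longrightarrow> x [^] (r::nat) \<in> powers (q * r)"
  unfolding powers_def by (auto simp: nat_pow_pow)

lemma powers_mult_subset: "powers (q * r) \<subseteq> powers q"
proof
  fix a assume "a \<in> powers (q * r)"
  then obtain x where x: "x \<in> carrier G" "a = x [^] (q * r)" unfolding powers_def by blast
  then have "a = (x [^] r) [^] q" by (simp add: nat_pow_pow mult.commute)
  then show "a \<in> powers q" unfolding powers_def using x(1) by blast
qed

lemma int_pow_in_powers:
  assumes "x \<in> carrier G" "int q dvd a"
  shows "x [^] a \<in> powers q"
proof -
  obtain b where "a = b * int q" using assms(2) by (auto simp: dvd_def mult.commute)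
  then have "x [^] a = (x [^] b) [^] q" using assms(1) by (simp add: int_pow_pow flip: int_pow_int)
  then show ?thesis unfolding powers_def using assms(1) by auto
qed

lemma dvd_of_int_pow_in_powers:
  assumes p: "prime p" and x: "x \<in> carrier G" "x \<notin> powers p" and b: "x [^] (b::int) \<in> powers p"
  shows "int p dvd b"
proof (rule ccontr)
  assume "\<not> int p dvd b"
  then have "coprime b (int p)" using p by (metis coprime_commute prime_imp_coprime prime_nat_int_transfer)
  then obtain u v where uv: "u * b + v * int p = 1" using bezout_int[of b "int p"] by auto
  have "x = x [^] (b * u + int p * v)" using uv x by (simp add: mult.commute int_pow_1)
  also have "\<dots> = (x [^] b) [^] u \<otimes> (x [^] int p) [^] v" using x by (simp add: int_pow_mult int_pow_pow)
  also have "\<dots> \<in> powers p"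
    by (intro subgroup.m_closed[OF powers_subgroup] subgroup_int_pow_closed[OF powers_subgroup b]
        subgroup_int_pow_closed[OF powers_subgroup int_pow_in_powers[OF x(1)]]) simp
  finally show False using x(2) by simp
qed

context
  assumes torsion_free: "\<And>x m. \<lbrakk>x \<in> carrier G; x [^] (m::nat) = \<one>; m > 0\<rbrakk> \<Longrightarrow> x = \<one>"
begin

lemma pow_inj:
  assumes "x \<in> carrier G" "y \<in> carrier G" "x [^] (q::nat) = y [^] q" "q > 0"
  shows "x = y"
proof -
  have "(x \<otimes> inv y) [^] q = \<one>" using assms by (simp add: nat_pow_distrib nat_pow_inv)
  then have "x \<otimes> inv y = \<one>" using torsion_free assms by simp
  then show ?thesis using assms by (metis inv_closed inv_equality inv_inv)
qed

lemma in_powers_of_pow: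
  assumes "x \<in> carrier G" "x [^] (r::nat) \<in> powers (q * r)" "r > 0"
  shows "x \<in> powers q"
proof -
  obtain g where g: "g \<in> carrier G" "x [^] r = g [^] (q * r)" using assms(2) unfolding powers_def by blast
  then have "x [^] r = (g [^] q) [^] r" by (simp add: nat_pow_pow)
  then have "x = g [^] q" using pow_inj assms g by simp
  then show ?thesis unfolding powers_def using g by blast
qed

text \<open>If \<open>y [^] p ^ m\<close> is a power of \<open>x\<close> up to a \<open>p ^ (m + 1)\<close>-th power, then \<open>y\<close> is one up to a
  \<open>p\<close>-th power: for \<open>m > 0\<close> the exponent of \<open>x\<close> is divisible by \<open>p\<close>, and in a torsion-free group a factor \<open>p\<close> can
  be cancelled throughout.\<close>
lemma generates_mod_powers_descent:
  assumes p: "prime p" and x: "x \<in> carrier G" "x \<notin> powers p" and y: "y \<in> carrier G"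
  shows "y [^] (p ^ m) \<otimes> x [^] (b::int) \<in> powers (p ^ Suc m) \<Longrightarrow> \<exists>a::int. y \<otimes> x [^] a \<in> powers p"
proof (induction m arbitrary: b)
  case 0
  then show ?case using y by (auto simp: nat_pow_eone)
next
  case (Suc m)
  have p0: "p > 0" using p by (rule prime_gt_0_nat)
  have 1: "y [^] (p ^ Suc m) \<otimes> x [^] b \<in> powers p"
    using Suc.prems powers_mult_subset[of p "p ^ Suc m"] by auto
  have 2: "y [^] (p ^ Suc m) \<in> powers p"
    using powers_mult_subset[of p "p ^ m"] y unfolding powers_def by auto
  have "inv (y [^] (p ^ Suc m)) \<otimes> (y [^] (p ^ Suc m) \<otimes> x [^] b) \<in> powers p"
    by (rule subgroup.m_closed[OF powers_subgroup subgroup.m_inv_closed[OF powers_subgroup 2] 1])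
  then have "x [^] b \<in> powers p" using x y by simp
  then have "int p dvd b" by (rule dvd_of_int_pow_in_powers[OF p x])
  then obtain c where c: "b = c * int p" by (auto simp: dvd_def mult.commute)
  have "(x [^] c) [^] p = x [^] b" unfolding c using x by (simp add: int_pow_pow flip: int_pow_int)
  then have "(y [^] (p ^ m) \<otimes> x [^] c) [^] p = y [^] (p ^ Suc m) \<otimes> x [^] b"
    using x y by (simp add: nat_pow_distrib nat_pow_pow mult.commute)
  then have "(y [^] (p ^ m) \<otimes> x [^] c) [^] p \<in> powers (p ^ Suc m * p)"
    using Suc.prems by (simp add: mult.commute mult.left_commute)
  then have "y [^] (p ^ m) \<otimes> x [^] c \<in> powers (p ^ Suc m)"
    by (rule in_powers_of_pow[rotated]) (use x y p0 in auto)
  then show ?case by (rule Suc.IH)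
qed

lemma exists_int_pow_mod_powers:
  assumes x: "x \<in> carrier G" and gen: "\<And>y. y \<in> carrier G \<Longrightarrow> \<exists>a::int. y \<otimes> x [^] a \<in> powers p"
  shows "y \<in> carrier G \<Longrightarrow> \<exists>a::int. y \<otimes> x [^] a \<in> powers (p ^ n)"
proof (induction n)
  case 0
  then show ?case unfolding powers_def using x by (auto simp: nat_pow_eone)
next
  case (Suc n)
  then obtain a :: int where a: "y \<otimes> x [^] a \<in> powers (p ^ n)" by blast
  then obtain h where h: "h \<in> carrier G" "y \<otimes> x [^] a = h [^] (p ^ n)" unfolding powers_def by blast
  obtain b :: int where b: "h \<otimes> x [^] b \<in> powers p" using gen[OF h(1)] by blast
  have "y \<otimes> x [^] (a + b * int (p ^ n)) = (y \<otimes> x [^] a) \<otimes> (x [^] b) [^] (p ^ n)"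
    using x Suc.prems by (simp add: int_pow_mult int_pow_pow m_assoc flip: int_pow_int)
  also have "\<dots> = (h \<otimes> x [^] b) [^] (p ^ n)" unfolding h(2) using h(1) x by (simp add: nat_pow_distrib)
  also have "\<dots> \<in> powers (p * p ^ n)" using b by (rule powers_pow)
  finally show ?case by auto
qed

lemma int_pow_in_prime_powers_iff:
  assumes p: "prime p" and x: "x \<in> carrier G" "x \<notin> powers p"
  shows "x [^] (a::int) \<in> powers (p ^ n) \<longleftrightarrow> int (p ^ n) dvd a"
proof
  show "x [^] a \<in> powers (p ^ n) \<Longrightarrow> int (p ^ n) dvd a"
  proof (induction n arbitrary: a)
    case (Suc n)
    have "x [^] a \<in> powers p" using Suc.prems powers_mult_subset[of p "p ^ n"] by auto
    then have "int p dvd a" by (rule dvd_of_int_pow_in_powers[OF p x])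
    then obtain c where c: "a = c * int p" by (auto simp: dvd_def mult.commute)
    have "(x [^] c) [^] p = x [^] a" unfolding c using x by (simp add: int_pow_pow flip: int_pow_int)
    then have "(x [^] c) [^] p \<in> powers (p ^ n * p)" using Suc.prems by (simp add: mult.commute)
    then have "x [^] c \<in> powers (p ^ n)"
      by (rule in_powers_of_pow[rotated]) (use x prime_gt_0_nat[OF p] in auto)
    then have "int (p ^ n) dvd c" by (rule Suc.IH)
    then show ?case unfolding c by (simp add: mult.commute)
  qed simp
qed (rule int_pow_in_powers[OF x(1)])

end

end

section \<open>Abelian just infinite groups\<close>

lemma carrier_padic_int_group:
  assumes "p > 0"
  shows "z \<in> carrier (padic_int_group p) \<longleftrightarrow>
    (\<forall>n. z n \<in> {0..<int (p ^ n)} \<and> z (Suc n) mod int (p ^ n) = z n)"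
  using assms unfolding padic_int_group_def by (auto simp: carrier_integer_mod_group PiE_iff)

lemma mult_padic_int_group:
  "(y \<otimes>\<^bsub>padic_int_group p\<^esub> z) n = (y n + z n) mod int (p ^ n)"
  unfolding padic_int_group_def by simp

lemma topspace_padic_int_topology: "topspace (padic_int_topology p) = carrier (padic_int_group p)"
  unfolding padic_int_topology_def padic_int_group_def by auto

lemma Hausdorff_padic_int_topology: "Hausdorff_space (padic_int_topology p)"
  unfolding padic_int_topology_def
  by (intro Hausdorff_space_subtopology) (simp add: Hausdorff_space_product_topology)

context pro_p_group
begin

lemma powers_open_normal:
  assumes comm: "\<And>x y. \<lbrakk>x \<in> carrier G; y \<in> carrier G\<rbrakk> \<Longrightarrow> x \<otimes> y = y \<otimes> x"
    and ji: "\<And>F. \<lbrakk>F \<lhd> G; closedin T F; F \<noteq> {\<one>}\<rbrakk> \<Longrightarrow> openin T F"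
    and nd: "\<not> openin T {\<one>}"
    and tf: "\<And>x m. \<lbrakk>x \<in> carrier G; x [^] (m::nat) = \<one>; m > 0\<rbrakk> \<Longrightarrow> x = \<one>" and q: "q > 0"
  shows "open_normal G T (powers q)"
proof -
  interpret C: comm_group G by (rule group_comm_groupI) (rule comm)
  have n: "powers q \<lhd> G" by (rule C.subgroup_imp_normal[OF C.powers_subgroup])
  have "compactin T (powers q)"
    unfolding powers_def using image_compactin[OF _ continuous_map_pow, of "topspace T" q] compact
    by (simp add: compact_space_def topspace_eq_carrier)
  then have cl: "closedin T (powers q)" using compactin_imp_closedin[OF Hausdorff] by blast
  have "carrier G \<noteq> {\<one>}" using nd openin_topspace[of T] topspace_eq_carrier by metis
  then obtain x where x: "x \<in> carrier G" "x \<noteq> \<one>" using one_closed by blast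
  then have "x [^] q \<in> powers q" "x [^] q \<noteq> \<one>" using tf[of x q] q unfolding powers_def by blast+
  then have "powers q \<noteq> {\<one>}" by blast
  then show ?thesis unfolding open_normal_def using n ji[OF n cl] by blast
qed

text \<open>An infinite abelian just infinite pro-\<open>p\<close> group is torsion-free. The subgroups of
  \<open>p ^ n\<close>-th powers form a base of neighbourhoods of the identity, and every \<open>x\<close> that is not a \<open>p\<close>-th power
  generates all of the quotients by them: the closure of the powers of \<open>x\<close> is open, so some
  \<open>y [^] p ^ m\<close> is a power of \<open>x\<close> up to a \<open>p ^ (m + 1)\<close>-th power, and \<open>m\<close> descends to zero. Reading off
  exponents of \<open>x\<close> gives the isomorphism with the \<open>p\<close>-adic integers.\<close>
lemma abelian_just_infinite_iso_padic:
  assumes p: "prime p" and comm: "\<And>x y. \<lbrakk>x \<in> carrier G; y \<in> carrier G\<rbrakk> \<Longrightarrow> x \<otimes> y = y \<otimes> x"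
    and ji: "\<And>F. \<lbrakk>F \<lhd> G; closedin T F; F \<noteq> {\<one>}\<rbrakk> \<Longrightarrow> openin T F"
    and nd: "\<not> openin T {\<one>}"
  shows "topological_group_iso G T (padic_int_group p) (padic_int_topology p)"
proof -
  interpret C: comm_group G by (rule group_comm_groupI) (rule comm)
  have p0: "p > 0" by (rule prime_gt_0_nat[OF p])
  have tf: "x = \<one>" if "x \<in> carrier G" "x [^] (m::nat) = \<one>" "m > 0" for x m
  proof -
    have c: "comm x g = \<one>" if g: "g \<in> carrier G" for g
      using \<open>x \<in> carrier G\<close> g comm[of x g] by (simp add: m_assoc)
    from ji nd that(1) c that(3,2) show ?thesis by (rule central_torsion_trivial)
  qed
  define P where "P n = powers (p ^ n)" for n
  have P: "open_normal G T (P n)" for n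
    unfolding P_def using comm ji nd tf by (rule powers_open_normal) (use p0 in simp_all)
  note P' = open_normalD[OF P]
  have P_Suc: "P (Suc n) \<subseteq> P n" for n
    unfolding P_def using C.powers_mult_subset[of "p ^ n" p] by (simp add: mult.commute)
  have P_base: "\<exists>n. P n \<subseteq> N" if N: "open_normal G T N" for N
  proof -
    obtain k where k: "group_index G N = enat (p ^ k)" using index_prime_power[OF N] by blast
    then have "card (rcosets N) = p ^ k" unfolding group_index_open_normal[OF N] by simp
    then have "P k \<subseteq> N"
      unfolding P_def powers_def using normal.pow_index_mem[OF open_normalD(1,5)[OF N]] by auto
    then show ?thesis by blast
  qed
  have P_Inter: "x = \<one>" if "x \<in> carrier G" "\<And>n. x \<in> P n" for x
    by (rule eq_one_of_in_open_normals[OF that(1)]) (use P_base that(2) in blast)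
  obtain x where x: "x \<in> carrier G" "x \<notin> powers p"
  proof (rule ccontr)
    assume "\<not> thesis"
    then have all: "carrier G \<subseteq> powers p" using that by blast
    have "carrier G \<subseteq> P n" for n
    proof (induction n)
      case 0 then show ?case unfolding P_def powers_def by (auto simp: nat_pow_eone)
    next
      case (Suc n)
      show ?case
      proof
        fix y assume "y \<in> carrier G"
        then obtain z where z: "z \<in> carrier G" "y = z [^] (p ^ n)" using Suc unfolding P_def powers_def by blast
        then have "y \<in> powers (p * p ^ n)" using C.powers_pow[of z p "p ^ n"] all by blast
        then show "y \<in> P (Suc n)" unfolding P_def by simp
      qed
    qed
    then have "carrier G = {\<one>}" using P_Inter one_closed by blast
    then show False using nd openin_topspace[of T] topspace_eq_carrier by metis
  qed
  define X where "X = range (\<lambda>a::int. x [^] a)"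
  have X: "subgroup X G"
  proof (rule subgroupI)
    show "X \<subseteq> carrier G" "X \<noteq> {}" unfolding X_def using x by auto
  next
    fix a assume "a \<in> X"
    then obtain i :: int where "a = x [^] i" unfolding X_def by blast
    then have "inv a = x [^] (- i)" using x(1) by (simp add: int_pow_neg)
    then show "inv a \<in> X" unfolding X_def by blast
  next
    fix a b assume "a \<in> X" "b \<in> X"
    then obtain i j :: int where "a = x [^] i" "b = x [^] j" unfolding X_def by blast
    then have "a \<otimes> b = x [^] (i + j)" using x(1) by (simp add: int_pow_mult)
    then show "a \<otimes> b \<in> X" unfolding X_def by blast
  qed
  have Xc: "X \<subseteq> carrier G" by (rule subgroup.subset[OF X])
  have gen: "\<exists>a::int. y \<otimes> x [^] a \<in> powers p" if y: "y \<in> carrier G" for y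
  proof -
    let ?A = "T closure_of X"
    have A: "?A \<lhd> G" by (rule C.subgroup_imp_normal[OF subgroup_closure[OF X]])
    have "x [^] (1::int) \<in> X" unfolding X_def by blast
    then have "x \<in> ?A" using closure_of_subset[of X T] Xc x(1) by (auto simp: topspace_eq_carrier int_pow_1)
    moreover have "x \<noteq> \<one>" using x(2) subgroup.one_closed[OF C.powers_subgroup] by blast
    ultimately have "openin T ?A" using ji[OF A closedin_closure_of] by blast
    then obtain m where m: "P m \<subseteq> ?A" using P_base A unfolding open_normal_def by blast
    have "y [^] (p ^ m) \<in> P m" unfolding P_def powers_def using y by blast
    then have "y [^] (p ^ m) \<in> ?A" using m by blast
    then obtain s where s: "s \<in> X" "y [^] (p ^ m) \<otimes> inv s \<in> P (Suc m)"
      using P[of "Suc m"] unfolding in_closure_iff[OF Xc] by blast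
    then obtain b :: int where "s = x [^] b" unfolding X_def by blast
    then have "y [^] (p ^ m) \<otimes> x [^] (- b) \<in> powers (p ^ Suc m)"
      using s(2) x(1) unfolding P_def by (simp add: int_pow_neg)
    with tf p x y show ?thesis by (rule C.generates_mod_powers_descent)
  qed
  have rep: "\<exists>a::int. y \<otimes> x [^] a \<in> P n" if "y \<in> carrier G" for y n
    unfolding P_def using tf x(1) gen that by (rule C.exists_int_pow_mod_powers)
  have iff: "x [^] (a::int) \<in> P n \<longleftrightarrow> int (p ^ n) dvd a" for a n
    unfolding P_def using tf p x by (rule C.int_pow_in_prime_powers_iff)
  define q where "q n = int (p ^ n)" for n
  have q0: "q n > 0" for n unfolding q_def using p0 by simp
  have rep': "\<exists>a. a \<in> {0..<q n} \<and> y \<otimes> x [^] (- a) \<in> P n" if y: "y \<in> carrier G" for y n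
  proof -
    obtain b :: int where b: "y \<otimes> x [^] b \<in> P n" using rep[OF y] by blast
    define a where "a = (- b) mod q n"
    have "q n dvd - b - a" unfolding a_def by (simp add: minus_mod_eq_mult_div)
    then have "x [^] (- b - a) \<in> P n" unfolding iff q_def .
    then have "(y \<otimes> x [^] b) \<otimes> x [^] (- b - a) \<in> P n" using subgroup.m_closed[OF P'(2) b] by blast
    also have "(y \<otimes> x [^] b) \<otimes> x [^] (- b - a) = y \<otimes> (x [^] b \<otimes> x [^] (- b - a))"
      using x y by (simp add: m_assoc)
    also have "x [^] b \<otimes> x [^] (- b - a) = x [^] (- a)" using x by (simp add: int_pow_mult[symmetric])
    finally show ?thesis unfolding a_def using q0 by (intro exI[of _ "(- b) mod q n"]) simp
  qed
  \<comment> \<open>The exponent of \<open>x\<close> representing \<open>y\<close> modulo \<open>P n\<close>; it is unique in the given range.\<close>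
  define f where "f y n = (SOME a. a \<in> {0..<q n} \<and> y \<otimes> x [^] (- a) \<in> P n)" for y n
  have f: "f y n \<in> {0..<q n}" "y \<otimes> x [^] (- f y n) \<in> P n" if "y \<in> carrier G" for y n
    using someI_ex[OF rep'[OF that, of n]] unfolding f_def by blast+
  have f_cong: "q n dvd f y n - a" if y: "y \<in> carrier G" and a: "y \<otimes> x [^] (- a) \<in> P n" for y n a
  proof -
    have "inv (y \<otimes> x [^] (- f y n)) \<otimes> (y \<otimes> x [^] (- a)) \<in> P n"
      by (rule subgroup.m_closed[OF P'(2) subgroup.m_inv_closed[OF P'(2) f(2)[OF y]] a])
    also have "inv (y \<otimes> x [^] (- f y n)) \<otimes> (y \<otimes> x [^] (- a)) = x [^] (f y n) \<otimes> x [^] (- a)"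
      using x y by (simp add: int_pow_neg inv_mult_group m_assoc)
    also have "\<dots> = x [^] (f y n - a)" using x by (simp add: int_pow_mult[symmetric])
    finally show ?thesis unfolding iff q_def .
  qed
  have f_eq: "f y n = a mod q n" if y: "y \<in> carrier G" and a: "y \<otimes> x [^] (- a) \<in> P n" for y n a
    using f_cong[OF that] f(1)[OF y, of n] by (metis atLeastLessThan_iff mod_eq_dvd_iff mod_pos_pos_trivial)
  have f_carrier: "f y \<in> carrier (padic_int_group p)" if y: "y \<in> carrier G" for y
    unfolding carrier_padic_int_group[OF p0]
  proof (intro allI conjI)
    fix n
    show "f y n \<in> {0..<int (p ^ n)}" using f(1)[OF y] unfolding q_def .
    have "y \<otimes> x [^] (- f y (Suc n)) \<in> P n" using f(2)[OF y] P_Suc by blast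
    then show "f y (Suc n) mod int (p ^ n) = f y n" using f_eq[OF y] unfolding q_def by simp
  qed
  have f_mult: "f (y \<otimes> z) = f y \<otimes>\<^bsub>padic_int_group p\<^esub> f z" if y: "y \<in> carrier G" and z: "z \<in> carrier G" for y z
  proof
    fix n
    have "(y \<otimes> x [^] (- f y n)) \<otimes> (z \<otimes> x [^] (- f z n)) \<in> P n"
      by (rule subgroup.m_closed[OF P'(2) f(2)[OF y] f(2)[OF z]])
    also have "(y \<otimes> x [^] (- f y n)) \<otimes> (z \<otimes> x [^] (- f z n)) = (y \<otimes> z) \<otimes> (x [^] (- f y n) \<otimes> x [^] (- f z n))"
      using x y z by (simp add: C.m_ac)
    also have "x [^] (- f y n) \<otimes> x [^] (- f z n) = x [^] (- (f y n + f z n))"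
      using x by (simp add: int_pow_mult[symmetric])
    finally show "f (y \<otimes> z) n = (f y \<otimes>\<^bsub>padic_int_group p\<^esub> f z) n"
      unfolding mult_padic_int_group using f_eq[OF m_closed[OF y z]] unfolding q_def by blast
  qed
  have f_inj: "inj_on f (carrier G)"
  proof (rule inj_onI)
    fix y z assume y: "y \<in> carrier G" and z: "z \<in> carrier G" and eq: "f y = f z"
    have "y \<otimes> inv z \<in> P n" for n
    proof -
      have "(y \<otimes> x [^] (- f y n)) \<otimes> inv (z \<otimes> x [^] (- f z n)) \<in> P n"
        by (rule subgroup.m_closed[OF P'(2) f(2)[OF y] subgroup.m_inv_closed[OF P'(2) f(2)[OF z]]])
      moreover have "(y \<otimes> x [^] (- f y n)) \<otimes> inv (z \<otimes> x [^] (- f z n)) = y \<otimes> inv z"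
        unfolding eq using x y z by (simp add: m_assoc inv_mult_group)
      ultimately show ?thesis by simp
    qed
    then have "y \<otimes> inv z = \<one>" using P_Inter[of "y \<otimes> inv z"] y z by simp
    then show "y = z" using y z by (metis inv_closed inv_equality inv_inv)
  qed
  have coset_iff: "y \<in> P n #> x [^] a \<longleftrightarrow> y \<otimes> x [^] (- a) \<in> P n" if "y \<in> carrier G" for y n and a :: int
    using subgroup.rcos_module[OF P'(2) is_group, of "x [^] a" y] that x by (simp add: int_pow_neg)
  \<comment> \<open>The cosets prescribed by a compatible sequence of residues are nested and compact.\<close>
  have f_surj: "f ` carrier G = carrier (padic_int_group p)"
  proof (intro equalityI subsetI)
    fix z assume z: "z \<in> carrier (padic_int_group p)"
    then have z': "z n \<in> {0..<q n}" "z (Suc n) mod q n = z n" for n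
      unfolding carrier_padic_int_group[OF p0] q_def by blast+
    define C where "C n = P n #> x [^] (z n)" for n
    have Cc: "C n \<subseteq> carrier G" for n
      unfolding C_def using r_coset_subset_G[OF subgroup.subset[OF P'(2)]] x by simp
    have "(\<Inter>n. C n) \<noteq> {}"
    proof (rule compact_space_imp_nest[OF compact])
      show "closedin T (C n)" for n unfolding C_def by (rule closedin_rcos[OF P'(4)]) (simp add: x)
      show "C n \<noteq> {}" for n unfolding C_def using rcos_self[OF _ P'(2), of "x [^] z n" n] x by auto
      show "decseq C"
      proof (rule decseq_SucI, rule subsetI)
        fix n y assume y: "y \<in> C (Suc n)"
        have yc: "y \<in> carrier G" using y Cc by blast
        have 1: "y \<otimes> x [^] (- z (Suc n)) \<in> P n"
          using y P_Suc unfolding C_def coset_iff[OF yc] by blast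
        have "q n dvd z (Suc n) - z n" using z'(2)[of n] by (metis dvd_minus_mod)
        then have 2: "x [^] (z (Suc n) - z n) \<in> P n" unfolding iff q_def .
        have "(y \<otimes> x [^] (- z (Suc n))) \<otimes> x [^] (z (Suc n) - z n) \<in> P n"
          by (rule subgroup.m_closed[OF P'(2) 1 2])
        also have "(y \<otimes> x [^] (- z (Suc n))) \<otimes> x [^] (z (Suc n) - z n)
            = y \<otimes> (x [^] (- z (Suc n)) \<otimes> x [^] (z (Suc n) - z n))"
          using x yc by (simp add: m_assoc)
        also have "x [^] (- z (Suc n)) \<otimes> x [^] (z (Suc n) - z n) = x [^] (- z n)"
          using x by (simp add: int_pow_mult[symmetric])
        finally show "y \<in> C n" unfolding C_def coset_iff[OF yc] .
      qed
    qed
    then obtain y where y: "\<And>n. y \<in> C n" by blast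
    then have yc: "y \<in> carrier G" using Cc by blast
    have "f y n = z n" for n
    proof -
      have "y \<otimes> x [^] (- z n) \<in> P n" using y[of n] unfolding C_def coset_iff[OF yc] .
      then have "f y n = z n mod q n" by (rule f_eq[OF yc])
      then show ?thesis using z'(1)[of n] by simp
    qed
    then have "z = f y" by auto
    then show "z \<in> f ` carrier G" using yc by blast
  next
    fix z assume "z \<in> f ` carrier G"
    then show "z \<in> carrier (padic_int_group p)" using f_carrier by blast
  qed
  have f_cont: "continuous_map T (padic_int_topology p) f"
    unfolding padic_int_topology_def continuous_map_in_subtopology continuous_map_componentwise_UNIV
  proof (intro conjI allI)
    show "f \<in> topspace T \<rightarrow> carrier (padic_int_group p)"
      using f_carrier topspace_eq_carrier by blast
  next
    fix n
    show "continuous_map T (discrete_topology (carrier (integer_mod_group (p ^ n)))) (\<lambda>y. f y n)"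
      unfolding continuous_map_def
    proof (intro conjI allI impI)
      show "(\<lambda>y. f y n) \<in> topspace T \<rightarrow> topspace (discrete_topology (carrier (integer_mod_group (p ^ n))))"
        using f(1) p0 unfolding q_def topspace_eq_carrier by (auto simp: carrier_integer_mod_group)
    next
      fix U assume "openin (discrete_topology (carrier (integer_mod_group (p ^ n)))) U"
      have "{y \<in> topspace T. f y n \<in> U} = (\<Union>a\<in>U \<inter> {0..<q n}. P n #> x [^] a)"
      proof (intro equalityI subsetI)
        fix y assume "y \<in> {y \<in> topspace T. f y n \<in> U}"
        then have y: "y \<in> carrier G" "f y n \<in> U" unfolding topspace_eq_carrier by blast+
        then have "y \<in> P n #> x [^] (f y n)" "f y n \<in> U \<inter> {0..<q n}"
          using f[OF y(1)] coset_iff[OF y(1)] by blast+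
        then show "y \<in> (\<Union>a\<in>U \<inter> {0..<q n}. P n #> x [^] a)" by blast
      next
        fix y assume "y \<in> (\<Union>a\<in>U \<inter> {0..<q n}. P n #> x [^] a)"
        then obtain a where a: "a \<in> U" "a \<in> {0..<q n}" "y \<in> P n #> x [^] a" by blast
        have y: "y \<in> carrier G"
          using a(3) r_coset_subset_G[OF subgroup.subset[OF P'(2)], of "x [^] a" n] x by auto
        have "f y n = a mod q n" using a(3) unfolding coset_iff[OF y] by (rule f_eq[OF y])
        then show "y \<in> {y \<in> topspace T. f y n \<in> U}" using a(1,2) y by (simp add: topspace_eq_carrier)
      qed
      moreover have "openin T (P n #> x [^] a)" for a :: int
        by (rule openin_rcos[OF P'(3)]) (simp add: x)
      ultimately show "openin T {y \<in> topspace T. f y n \<in> U}" by auto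
    qed
  qed
  have "homeomorphic_map T (padic_int_topology p) f"
    by (rule continuous_imp_homeomorphic_map[OF f_cont compact Hausdorff_padic_int_topology])
       (use f_surj f_inj in \<open>simp_all add: topspace_padic_int_topology topspace_eq_carrier\<close>)
  moreover have "f \<in> iso G (padic_int_group p)"
    unfolding iso_def bij_betw_def hom_def using f_carrier f_mult f_inj f_surj by auto
  ultimately show ?thesis unfolding topological_group_iso_def by blast
qed

end

section \<open>The \<open>p\<close>-adic integers\<close>

text \<open>Divisibility modulo a prime power is linear.\<close>
lemma dvd_linear_mod_primepow:
  fixes a b :: int
  assumes p: "prime (p::nat)"
  shows "\<exists>c. int (p ^ m) dvd b - c * a \<or> int (p ^ m) dvd a - c * b"
proof -
  have *: "\<exists>c. int (p ^ m) dvd t - c * s" if dvd: "gcd s (int (p ^ m)) dvd t" for s t :: int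
  proof -
    obtain u v where uv: "u * s + v * int (p ^ m) = gcd s (int (p ^ m))" using bezout_int by blast
    obtain r where "t = gcd s (int (p ^ m)) * r" using dvd by blast
    then have "t - (r * u) * s = int (p ^ m) * (v * r)" unfolding uv[symmetric] by (simp add: algebra_simps)
    then show ?thesis by (metis dvd_triv_left)
  qed
  have pw: "\<exists>i. gcd s (int (p ^ m)) = int p ^ i" for s
  proof -
    have "nat (gcd s (int (p ^ m))) dvd p ^ m" by (simp add: nat_dvd_iff)
    then obtain i where "nat (gcd s (int (p ^ m))) = p ^ i" using divides_primepow_nat[OF p] by blast
    then have "gcd s (int (p ^ m)) = int (p ^ i)" by (metis gcd_ge_0_int int_nat_eq)
    then show ?thesis by auto
  qed
  obtain i j where ij: "gcd a (int (p ^ m)) = int p ^ i" "gcd b (int (p ^ m)) = int p ^ j" using pw by blast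
  show ?thesis
  proof (cases "i \<le> j")
    case True
    then have "gcd a (int (p ^ m)) dvd gcd b (int (p ^ m))" unfolding ij by (rule le_imp_power_dvd)
    then show ?thesis using *[of a b] by (meson dvd_trans gcd_dvd1)
  next
    case False
    then have "gcd b (int (p ^ m)) dvd gcd a (int (p ^ m))" unfolding ij by (intro le_imp_power_dvd) simp
    then show ?thesis using *[of b a] by (meson dvd_trans gcd_dvd1)
  qed
qed

context pro_p_group
begin

text \<open>The subgroups \<open>V n\<close> of the elements whose \<open>n\<close>-th residue vanishes form a base of neighbourhoods of the
  identity, by compactness. Given two open normal subgroups, both containing \<open>V m\<close>, and an element of each, one of
  the two elements is modulo \<open>V m\<close> a power of the other.\<close>
lemma iso_padic_open_normal_linear:
  assumes p: "prime p" and iso: "topological_group_iso G T (padic_int_group p) (padic_int_topology p)"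
    and N: "open_normal G T N" and K: "open_normal G T K"
  shows "N \<subseteq> K \<or> K \<subseteq> N"
proof -
  have p0: "p > 0" by (rule prime_gt_0_nat[OF p])
  obtain f where f: "f \<in> iso G (padic_int_group p)" "homeomorphic_map T (padic_int_topology p) f"
    using iso unfolding topological_group_iso_def by blast
  have fc: "f y \<in> carrier (padic_int_group p)" if "y \<in> carrier G" for y
    using f(1) that unfolding iso_def hom_def by blast
  have fm: "f (y \<otimes> z) = f y \<otimes>\<^bsub>padic_int_group p\<^esub> f z" if "y \<in> carrier G" "z \<in> carrier G" for y z
    using f(1) that unfolding iso_def hom_def by blast
  have finj: "inj_on f (carrier G)" using f(1) unfolding iso_def bij_betw_def by blast
  have hom: "group_hom G (integer_mod_group (p ^ n)) (\<lambda>y. f y n)" for n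
  proof (intro group_hom.intro group_hom_axioms.intro is_group group_integer_mod_group homI)
    fix y assume "y \<in> carrier G"
    then show "f y n \<in> carrier (integer_mod_group (p ^ n))"
      using fc[of y] p0 unfolding carrier_padic_int_group[OF p0] by (simp add: carrier_integer_mod_group)
  next
    fix y z assume "y \<in> carrier G" "z \<in> carrier G"
    then show "f (y \<otimes> z) n = f y n \<otimes>\<^bsub>integer_mod_group (p ^ n)\<^esub> f z n"
      by (simp add: fm mult_padic_int_group)
  qed
  define V where "V n = {y \<in> carrier G. f y n = 0}" for n
  have V_sub: "subgroup (V n) G" for n
    using group_hom.subgroup_kernel[OF hom[of n]] unfolding kernel_def V_def by simp
  have f_cont: "continuous_map T (padic_int_topology p) f" using f(2) by (rule homeomorphic_imp_continuous_map)
  have f_cont: "continuous_map T (discrete_topology (carrier (integer_mod_group (p ^ n)))) (\<lambda>y. f y n)" for n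
    using f_cont unfolding padic_int_topology_def continuous_map_in_subtopology continuous_map_componentwise_UNIV
    by blast
  have V_closed: "closedin T (V n)" for n
  proof -
    have "closedin (discrete_topology (carrier (integer_mod_group (p ^ n)))) {0}" by simp
    from closedin_continuous_map_preimage[OF f_cont this]
    show ?thesis unfolding V_def topspace_eq_carrier by simp
  qed
  have V_Suc: "V (Suc n) \<subseteq> V n" for n
  proof
    fix y assume "y \<in> V (Suc n)"
    then have y: "y \<in> carrier G" "f y (Suc n) = 0" unfolding V_def by blast+
    have "f y (Suc n) mod int (p ^ n) = f y n" using fc[OF y(1)] unfolding carrier_padic_int_group[OF p0] by blast
    then show "y \<in> V n" unfolding V_def using y by simp
  qed
  have V_one: "y = \<one>" if "\<And>n. y \<in> V n" for y
  proof -
    have y: "y \<in> carrier G" "\<And>n. f y n = 0" using that unfolding V_def by blast+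
    have "f \<one> n = 0" for n using subgroup.one_closed[OF V_sub] unfolding V_def by blast
    then have "f y = f \<one>" using y(2) by auto
    then show ?thesis using inj_onD[OF finj _ y(1) one_closed] by blast
  qed
  have V_base: "\<exists>n. V n \<subseteq> M" if M: "open_normal G T M" for M
  proof (rule ccontr)
    assume no: "\<not> (\<exists>n. V n \<subseteq> M)"
    note M' = open_normalD[OF M]
    have "(\<Inter>n. V n - M) \<noteq> {}"
    proof (rule compact_space_imp_nest[OF compact])
      show "closedin T (V n - M)" for n by (rule closedin_diff[OF V_closed M'(3)])
      show "V n - M \<noteq> {}" for n using no by blast
      show "decseq (\<lambda>n. V n - M)" by (rule decseq_SucI) (use V_Suc in blast)
    qed
    then obtain y where "\<And>n. y \<in> V n" "y \<notin> M" by blast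
    then show False using V_one subgroup.one_closed[OF M'(2)] by blast
  qed
  have V_anti: "V n \<subseteq> V m" if "m \<le> n" for m n
    using lift_Suc_antimono_le[of V, OF V_Suc that] .
  have mem: "h \<in> M" if M: "open_normal G T M" "V m \<subseteq> M" and g: "g \<in> M" and h: "h \<in> carrier G"
    and c: "int (p ^ m) dvd f h m - c * f g m" for M m g h and c :: int
  proof -
    note M' = open_normalD[OF M(1)]
    have gc: "g \<in> carrier G" using subgroup.mem_carrier[OF M'(2) g] .
    let ?e = "- c"
    have "f (h \<otimes> g [^] ?e) m = (f h m + (?e * f g m) mod int (p ^ m)) mod int (p ^ m)"
      using group_hom.hom_mult[OF hom h int_pow_closed[OF gc]] group_hom.hom_int_pow[OF hom gc]
      by (simp add: int_pow_integer_mod_group)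
    also have "\<dots> = (f h m - c * f g m) mod int (p ^ m)" by (simp add: mod_add_right_eq)
    also have "\<dots> = 0" using c by (rule dvd_imp_mod_0)
    finally have "h \<otimes> g [^] ?e \<in> M" using M(2) h gc unfolding V_def by auto
    moreover have "g [^] c \<in> M" by (rule subgroup_int_pow_closed[OF M'(2) g])
    ultimately have "h \<otimes> g [^] ?e \<otimes> g [^] c \<in> M" by (rule subgroup.m_closed[OF M'(2)])
    then show ?thesis using h gc by (simp add: int_pow_neg m_assoc)
  qed
  show ?thesis
  proof (rule ccontr)
    assume no: "\<not> ?thesis"
    then obtain g h where g: "g \<in> N" "g \<notin> K" and h: "h \<in> K" "h \<notin> N" by blast
    have c: "g \<in> carrier G" "h \<in> carrier G"
      using g(1) h(1) subgroup.mem_carrier open_normalD(2)[OF N] open_normalD(2)[OF K] by metis+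
    obtain m1 m2 where "V m1 \<subseteq> N" "V m2 \<subseteq> K" using V_base N K by blast
    then have V: "V (max m1 m2) \<subseteq> N" "V (max m1 m2) \<subseteq> K"
      using V_anti[of m1 "max m1 m2"] V_anti[of m2 "max m1 m2"] by auto
    obtain e where "int (p ^ max m1 m2) dvd f h (max m1 m2) - e * f g (max m1 m2)
        \<or> int (p ^ max m1 m2) dvd f g (max m1 m2) - e * f h (max m1 m2)"
      using dvd_linear_mod_primepow[OF p] by blast
    then show False
      using mem[OF N V(1) g(1) c(2)] mem[OF K V(2) h(1) c(1)] g(2) h(2) by blast
  qed
qed

text \<open>If the open normal subgroups form a chain, then \<open>normal_core_upto n\<close> is the smallest of those of
  index at most \<open>n\<close>, and it coincides with its obliquity subgroup.\<close>
lemma ob_le_of_linear: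
  assumes lin: "\<And>N K. \<lbrakk>open_normal G T N; open_normal G T K\<rbrakk> \<Longrightarrow> N \<subseteq> K \<or> K \<subseteq> N" and n: "n > 0"
  shows "ob G T n \<le> enat n"
proof -
  let ?I = "normal_core_upto G T n"
  let ?P = "\<lambda>N. open_normal G T N \<and> group_index G N \<le> enat n"
  define d where "d N = card (rcosets N)" for N
  have d: "group_index G N = enat (d N)" if "open_normal G T N" for N
    unfolding d_def by (rule group_index_open_normal[OF that])
  have "?P (carrier G)"
    using open_normal_carrier sub_index_self[OF subgroup_self] n
    by (simp add: group_index_def one_enat_def)
  then have "\<exists>N. ?P N \<and> (\<forall>K. ?P K \<longrightarrow> d K \<le> d N)"
    by (rule ex_has_greatest_nat[of ?P _ d "Suc n"]) (use d in \<open>auto simp: less_Suc_eq_le\<close>)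
  then obtain N where N: "open_normal G T N" "group_index G N \<le> enat n"
    and max: "\<And>K. ?P K \<Longrightarrow> d K \<le> d N" by blast
  note N' = open_normalD[OF N(1)]
  have "N \<subseteq> K" if K: "?P K" for K
  proof (rule ccontr)
    assume no: "\<not> N \<subseteq> K"
    then have KN: "K \<subseteq> N" using lin N(1) K by blast
    note K' = open_normalD[OF conjunct1[OF K]]
    have "group_index G K = group_index G N * sub_index G N K"
      unfolding group_index_def
      by (rule sub_index_mult[OF subgroup_self N'(2) K'(2) subgroup.subset[OF N'(2)] KN])
    then have eq: "enat (d K) = enat (d N) * sub_index G N K" using d N(1) K by simp
    have "d N \<noteq> 0"
      using sub_index_pos[OF carrier_not_empty, of N] d[OF N(1)] unfolding group_index_def
      by (simp add: one_enat_def)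
    then have "sub_index G N K \<le> 1"
      using eq max[OF K] by (cases "sub_index G N K") (auto simp: one_enat_def)
    then show False using sub_index_eq_1_imp[OF N'(2) K'(2) KN] no by blast
  qed
  then have I: "?I = N" unfolding normal_core_upto_def using N by blast
  have "Ob G T N = N" unfolding Ob_def using lin[OF N(1)] by blast
  then show ?thesis unfolding ob_def I using N(2) by simp
qed

end

theorem mainTheorem6:
  fixes p :: nat
    and G :: "('a, 'b) monoid_scheme"
    and T :: "'a topology"
  assumes "prime p"
    and "pro_p_group p G T"
  shows "(topological_group_iso G T (padic_int_group p) (padic_int_topology p)
            \<or> finite_obliquity p G T)
         \<longleftrightarrow> (\<exists>k :: real. \<forall>n > 0. ereal_of_enat (ob G T n) \<le> ereal (k * real n))"
    (is "?Z \<or> ?F \<longleftrightarrow> ?L")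
proof -
  interpret pro_p_group p G T by (rule assms(2))
  have linear: ?L if K: "\<And>n. n > 0 \<Longrightarrow> ob G T n \<le> enat (K * n)" for K
  proof (intro exI[of _ "real K"] allI impI)
    fix n :: nat assume "n > 0"
    then have "ereal_of_enat (ob G T n) \<le> ereal_of_enat (enat (K * n))"
      using K by (simp only: ereal_of_enat_le_iff)
    then show "ereal_of_enat (ob G T n) \<le> ereal (real K * real n)" by simp
  qed
  show ?thesis
  proof
    assume "?Z \<or> ?F"
    then show ?L
    proof
      assume Z: ?Z
      have "ob G T n \<le> enat n" if "n > 0" for n
        by (rule ob_le_of_linear[OF _ that]) (rule iso_padic_open_normal_linear[OF assms(1) Z])
      then show ?L using linear[of 1] by simp
    next
      assume ?F
      then obtain c where "\<And>i. openin T (lower_central G T (Suc i))"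
        and "\<And>i. sub_index G (lower_central G T (Suc i)) (Ob G T (lower_central G T (Suc i))) \<le> enat c"
        unfolding finite_obliquity_iff[OF assms(1)] by blast
      then show ?L using ob_linear_of_bounded_obliquity[OF assms(1)] linear by blast
    qed
  next
    assume ?L
    then obtain k :: real where k: "\<And>n. n > 0 \<Longrightarrow> ereal_of_enat (ob G T n) \<le> ereal (k * real n)" by blast
    have bd: "sub_index G H (Ob G T H) \<le> enat (nat \<lfloor>k\<rfloor>)" if "open_normal G T H" for H
      using k that by (rule Ob_index_bounded_of_ob_linear)
    have ji: "openin T F" if "F \<lhd> G" "closedin T F" "F \<noteq> {\<one>\<^bsub>G\<^esub>}" for F
    proof (rule just_infinite_of_Ob[OF _ that])
      fix H assume "open_normal G T H"
      then have "sub_index G H (Ob G T H) \<le> enat (nat \<lfloor>k\<rfloor>)" by (rule bd)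
      also have "\<dots> < \<infinity>" unfolding enat_ord_simps by (rule enat.distinct(1))
      finally show "sub_index G H (Ob G T H) < \<infinity>" .
    qed
    show "?Z \<or> ?F"
    proof (cases "\<forall>i. openin T (lower_central G T (Suc i))")
      case True
      then have "open_normal G T (lower_central G T (Suc i))" for i
        unfolding open_normal_def using lc_normal by blast
      then have ?F unfolding finite_obliquity_iff[OF assms(1)] using True bd by blast
      then show ?thesis ..
    next
      case False
      note cases = just_infinite_lc_cases[OF ji False]
      have ?Z by (rule abelian_just_infinite_iso_padic[OF assms(1) cases(2) ji cases(1)])
      then show ?thesis ..
    qed
  qed
qed

end
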